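(* Let $A$ be a regular multiplier Hopf algebra and let $(L,\cdot,\mathfrak{e})$ be a quasi unitary symmetric partial $A$-module algebra. Let $\varphi: L\to Hom^r(A,L)$ be the linear map $\varphi(x)(a)=a\cdot x$, and let $\pi':Hom^r(A,L)\to Hom^r(A,L)$ be the linear map given by $\pi'(f(\_\,a))=\varphi(f(a))$ for $f\in Hom(A,L)$, $a\in A$. Put $R=A\triangleright\varphi(L)$, where $\triangleright$ is the action of $A$ on $Hom^r(A,L)$ given by $a\triangleright f(\_\,b)=f(\_\,ab)$, and put $\pi=\pi'|_R$. Then $(R,\varphi,\pi)$ is a globalization (enveloping action) of $L$.
   Context: All vector spaces and algebras are over a fixed field $\Bbbk$, $\otimes=\otimes_\Bbbk$; algebras are associative and not necessarily unital. An algebra $B$ has a nondegenerate product if ($ab=0$ for all $b\in B$ implies $a=0$) and ($ab=0$ for all $a\in B$ implies $b=0$). Its multiplier algebra $M(B)$ consists of the pairs $m=(U,V)$ of linear maps $B\to B$ with $V(a)b=aU(b)$ for all $a,b\in B$, with product $(U,V)(U',V')=(U\circ U',V'\circ V)$ and unit $1=(\imath,\imath)$; write $mb=U(b)$, $bm=V(b)$; $B\subseteq M(B)$ via left and right multiplications. A multiplier Hopf algebra is a pair $(A,\Delta)$ where $A$ is an algebra with nondegenerate product and $\Delta:A\to M(A\otimes A)$ is an algebra homomorphism such that $\Delta(a)(1\otimes b)\in A\otimes A$, $(a\otimes 1)\Delta(b)\in A\otimes A$, $(a\otimes 1\otimes 1)((\Delta\otimes \imath)(\Delta(b)(1\otimes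 c)))=((\imath\otimes\Delta)((a\otimes 1)\Delta(b)))(1\otimes 1\otimes c)$ for all $a,b,c\in A$, and the maps $a\otimes b\mapsto \Delta(a)(1\otimes b)$ and $a\otimes b\mapsto (a\otimes 1)\Delta(b)$ are bijections of $A\otimes A$. It is regular if $(A,\sigma\Delta)$ is also a multiplier Hopf algebra ($\sigma$ the flip). Known facts: $A$ has bilateral local units (for $a_1,\dots,a_n\in A$ there is $e\in A$ with $ea_i=a_i=a_ie$), there are a unique counit $\varepsilon:A\to\Bbbk$ and antipode $S$, and if $A$ is regular then $S:A\to A$ is a bijective anti-homomorphism. Sweedler notation is used when covered: e.g. $a_{(1)}\otimes a_{(2)}b$ means $\Delta(a)(1\otimes b)$, $a_{(1)}b\otimes a_{(2)}$ means $\Delta(a)(b\otimes 1)$, and similarly for multiplication from the other side and after applying $S^{\pm1}$ to a leg; for regular $A$ these all lie in $A\otimes A$. Left $A$-module algebra: an algebra $R$ with nondegenerate product and a surjective linear map $\triangleright:A\otimes R\to R$ with $a\triangleright(b\triangleright x)=ab\triangleright x$ and $a\triangleright (xy)=(a_{(1)}\triangleright x)(a_{(2)}\triangleright y)$ (covered by writing $y=e\triangleright y$ with $e\in A$). Symmetric partial $A$-module algebra: a triple $(L,\cdot,\mathfrak{e})$ with $L$ an algebra with nondegenerate product and linear maps $\cdot:A\otimes L\to L$, $\mathfrak{e}:A\to M(L)$ such that for all $a,b\in A$, $x,y\in L$: (i) $a\cdot(x(b\cdot y))=(a_{(1)}\cdot x)(a_{(2)}b\cdot y)$; (ii) $\mathfrak{e}(a)(b\cdot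 x)=a_{(1)}\cdot(S(a_{(2)})b\cdot x)$ and $\mathfrak{e}(A)L\subseteq A\cdot L$; (iii) for $a_1,\dots,a_n\in A$, $x_1,\dots,x_m\in L$ there is $b\in A$ with $a_ib=a_i=ba_i$ and $a_i\cdot x_j=a_i\cdot(b\cdot x_j)$ for all $i,j$; (iv) $A\cdot x=0$ iff $x=0$; (v) $a\cdot((b\cdot x)y)=(a_{(1)}b\cdot x)(a_{(2)}\cdot y)$; (vi) $(b\cdot x)\mathfrak{e}(a)=a_{(2)}\cdot(S^{-1}(a_{(1)})b\cdot x)$; (vii) $L\mathfrak{e}(A)\subseteq A\cdot L$. $L$ is quasi unitary if for all $x_1,\dots,x_n\in L$ there is $b\in A$ with $b\cdot x_i=x_i$ and $ab\cdot x_i=a\cdot x_i$ for all $a\in A$ and all $i$. $Hom(A,L)$ is the space of linear maps $A\to L$; $f(\_\,a)$ denotes the map $c\mapsto f(ca)$; $Hom^r(A,L)$ is the span of all $f(\_\,a)$ with $f\in Hom(A,L)$, $a\in A$ (every element is of the form $f(\_\,a)$), an algebra under $(f(\_\,a)g(\_\,b))(c)=f(c_{(1)}a)g(c_{(2)}b)$. It is a left $A$-module algebra via $a\triangleright f(\_\,b)=f(\_\,ab)$. For quasi unitary $L$, $\varphi$ takes values in $Hom^r(A,L)$; $\pi'$ is well defined. $A\triangleright\varphi(L)$ denotes the linear span of all $a\triangleright\varphi(x)$. Symmetric $A$-projection: if $R$ is a left $A$-module algebra and $N\subseteq R$ is a subalgebra with nondegenerate product, a linear multiplicative map $\pi:R\to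 R$ with image $N$ and $\pi|_N=\mathrm{id}$ is a symmetric $A$-projection over $N$ if $\pi(a\triangleright(x(b\triangleright y)))=\pi(a\triangleright(x\pi(b\triangleright y)))$ and $\pi(a\triangleright((b\triangleright x)y))=\pi(a\triangleright(\pi(b\triangleright x)y))$ for all $x,y\in N$, $a,b\in A$. The induced partial action on $N$ is then $a\cdot x=\pi(a\triangleright x)$. A globalization (enveloping action) of a symmetric partial $A$-module algebra $L$ is a triple $(R,\theta,\pi)$ with: (i) $R$ a left $A$-module algebra; (ii) $\theta:L\to R$ an algebra monomorphism; (iii) $\theta(L)$ a bilateral ideal of $R$; (iv) $\pi:R\to R$ a symmetric $A$-projection over $\theta(L)$ with $\theta(a\cdot x)=\pi(a\triangleright\theta(x))$ for all $a\in A$, $x\in L$; (v) $R=A\triangleright\theta(L)$. *)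

theory Defs
  imports Complex_Main "HOL-Library.Function_Algebras" "HOL-Library.FuncSet"
begin

section \<open>Linear maps and algebras on subspaces\<close>

definition fscale :: "('k \<Rightarrow> 'v \<Rightarrow> 'v) \<Rightarrow> 'k \<Rightarrow> ('x \<Rightarrow> 'v) \<Rightarrow> ('x \<Rightarrow> 'v)" where
  "fscale s c f = (\<lambda>x. s c (f x))"

definition linear_on ::
  "('k \<Rightarrow> 'v::ab_group_add \<Rightarrow> 'v) \<Rightarrow> ('k \<Rightarrow> 'w::ab_group_add \<Rightarrow> 'w) \<Rightarrow> 'v set \<Rightarrow> 'w set \<Rightarrow> ('v \<Rightarrow> 'w) \<Rightarrow> bool"
where
  "linear_on s1 s2 V W f \<longleftrightarrow>
     (\<forall>x\<in>V. f x \<in> W) \<and>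
     (\<forall>x\<in>V. \<forall>y\<in>V. f (x + y) = f x + f y) \<and>
     (\<forall>c. \<forall>x\<in>V. f (s1 c x) = s2 c (f x))"

definition bilinear_on ::
  "('k \<Rightarrow> 'u::ab_group_add \<Rightarrow> 'u) \<Rightarrow> ('k \<Rightarrow> 'v::ab_group_add \<Rightarrow> 'v) \<Rightarrow> ('k \<Rightarrow> 'w::ab_group_add \<Rightarrow> 'w) \<Rightarrow>
   'u set \<Rightarrow> 'v set \<Rightarrow> 'w set \<Rightarrow> ('u \<Rightarrow> 'v \<Rightarrow> 'w) \<Rightarrow> bool"
where
  "bilinear_on s1 s2 s3 U V W f \<longleftrightarrow>
     (\<forall>x\<in>U. linear_on s2 s3 V W (f x)) \<and> (\<forall>y\<in>V. linear_on s1 s3 U W (\<lambda>x. f x y))"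

definition algebra_on ::
  "('k::field \<Rightarrow> 'v::ab_group_add \<Rightarrow> 'v) \<Rightarrow> 'v set \<Rightarrow> ('v \<Rightarrow> 'v \<Rightarrow> 'v) \<Rightarrow> bool"
where
  "algebra_on s B m \<longleftrightarrow>
     vector_space s \<and> module.subspace s B \<and> bilinear_on s s s B B B m \<and>
     (\<forall>x\<in>B. \<forall>y\<in>B. \<forall>z\<in>B. m (m x y) z = m x (m y z))"

definition nondegenerate_product :: "'v::zero set \<Rightarrow> ('v \<Rightarrow> 'v \<Rightarrow> 'v) \<Rightarrow> bool" where
  "nondegenerate_product B m \<longleftrightarrow>
     (\<forall>a\<in>B. (\<forall>b\<in>B. m a b = 0) \<longrightarrow> a = 0) \<and>
     (\<forall>b\<in>B. (\<forall>a\<in>B. m a b = 0) \<longrightarrow> b = 0)"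

section \<open>Multipliers\<close>

type_synonym 'v multiplier = "('v \<Rightarrow> 'v) \<times> ('v \<Rightarrow> 'v)"

text \<open>For a multiplier \<open>m = (U, V)\<close> of the algebra \<open>B\<close>, \<open>fst m b\<close> is \<open>m b\<close> and \<open>snd m b\<close> is \<open>b m\<close>.
  The two maps are extended by zero outside \<open>B\<close>, so that equality of pairs is equality in \<open>M(B)\<close>.\<close>

definition multipliers ::
  "('k \<Rightarrow> 'v::ab_group_add \<Rightarrow> 'v) \<Rightarrow> 'v set \<Rightarrow> ('v \<Rightarrow> 'v \<Rightarrow> 'v) \<Rightarrow> 'v multiplier set"
where
  "multipliers s B m =
     {(U, V). linear_on s s B B U \<and> linear_on s s B B V \<and>
        (\<forall>a\<in>B. \<forall>b\<in>B. m (V a) b = m a (U b)) \<and>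
        (\<forall>x. x \<notin> B \<longrightarrow> U x = 0 \<and> V x = 0)}"

definition mult_comp :: "'v multiplier \<Rightarrow> 'v multiplier \<Rightarrow> 'v multiplier" where
  "mult_comp m m' = (fst m \<circ> fst m', snd m' \<circ> snd m)"

definition mult_emb :: "'v::zero set \<Rightarrow> ('v \<Rightarrow> 'v \<Rightarrow> 'v) \<Rightarrow> 'v \<Rightarrow> 'v multiplier" where
  "mult_emb B m x = (\<lambda>y. if y \<in> B then m x y else 0, \<lambda>y. if y \<in> B then m y x else 0)"

section \<open>Tensor powers\<close>

text \<open>An elementary tensor is realised as the evaluation functional on bilinear forms, and
  \<open>A \<otimes> A\<close> as the span of these functionals. Over a field this is the tensor product: a sum
  \<open>\<Sum> a\<^sub>i \<otimes> b\<^sub>i\<close> vanishes iff every bilinear form takes it to 0.\<close>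

type_synonym ('a, 'k) tensor2 = "('a \<Rightarrow> 'a \<Rightarrow> 'k) \<Rightarrow> 'k"
type_synonym ('a, 'k) tensor3 = "('a \<Rightarrow> 'a \<Rightarrow> 'a \<Rightarrow> 'k) \<Rightarrow> 'k"

definition tens :: "('k::field \<Rightarrow> 'a::ab_group_add \<Rightarrow> 'a) \<Rightarrow> 'a \<Rightarrow> 'a \<Rightarrow> ('a, 'k) tensor2" where
  "tens s a b = (\<lambda>\<beta>. if bilinear_on s s (*) UNIV UNIV UNIV \<beta> then \<beta> a b else 0)"

definition tens3 ::
  "('k::field \<Rightarrow> 'a::ab_group_add \<Rightarrow> 'a) \<Rightarrow> 'a \<Rightarrow> 'a \<Rightarrow> 'a \<Rightarrow> ('a, 'k) tensor3"
where
  "tens3 s a b c =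
     (\<lambda>\<tau>. if (\<forall>x. bilinear_on s s (*) UNIV UNIV UNIV (\<tau> x)) \<and>
             (\<forall>y z. linear_on s (*) UNIV UNIV (\<lambda>x. \<tau> x y z))
          then \<tau> a b c else 0)"

definition tensor_space :: "('k::field \<Rightarrow> 'a::ab_group_add \<Rightarrow> 'a) \<Rightarrow> ('a, 'k) tensor2 set" where
  "tensor_space s = module.span (fscale (*)) {tens s a b |a b. True}"

text \<open>The linear map on \<open>A \<otimes> A\<close> induced by a bilinear map \<open>f\<close>, extended by zero.\<close>

definition tensor_lift ::
  "('k::field \<Rightarrow> 'a::ab_group_add \<Rightarrow> 'a) \<Rightarrow> ('a \<Rightarrow> 'a \<Rightarrow> 'w::ab_group_add) \<Rightarrow> ('a, 'k) tensor2 \<Rightarrow> 'w"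
where
  "tensor_lift s f t =
     (if t \<in> tensor_space s
      then (THE w. \<exists>ps. t = (\<Sum>(a, b)\<leftarrow>ps. tens s a b) \<and> w = (\<Sum>(a, b)\<leftarrow>ps. f a b))
      else 0)"

definition tensor_mult ::
  "('k::field \<Rightarrow> 'a::ring \<Rightarrow> 'a) \<Rightarrow> ('a, 'k) tensor2 \<Rightarrow> ('a, 'k) tensor2 \<Rightarrow> ('a, 'k) tensor2"
where
  "tensor_mult s t u =
     tensor_lift s (\<lambda>a b. tensor_lift s (\<lambda>c d. tens s (a * c) (b * d)) u) t"

text \<open>The multipliers \<open>a \<otimes> 1\<close> and \<open>1 \<otimes> a\<close> of \<open>A \<otimes> A\<close>.\<close>

definition leg1 :: "('k::field \<Rightarrow> 'a::ring \<Rightarrow> 'a) \<Rightarrow> 'a \<Rightarrow> ('a, 'k) tensor2 multiplier" where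
  "leg1 s a = (tensor_lift s (\<lambda>p q. tens s (a * p) q), tensor_lift s (\<lambda>p q. tens s (p * a) q))"

definition leg2 :: "('k::field \<Rightarrow> 'a::ring \<Rightarrow> 'a) \<Rightarrow> 'a \<Rightarrow> ('a, 'k) tensor2 multiplier" where
  "leg2 s a = (tensor_lift s (\<lambda>p q. tens s p (a * q)), tensor_lift s (\<lambda>p q. tens s p (q * a)))"

definition tensor_emb ::
  "('k::field \<Rightarrow> 'a::ring \<Rightarrow> 'a) \<Rightarrow> ('a, 'k) tensor2 \<Rightarrow> ('a, 'k) tensor2 multiplier"
where
  "tensor_emb s = mult_emb (tensor_space s) (tensor_mult s)"

definition tensor_elem ::
  "('k::field \<Rightarrow> 'a::ring \<Rightarrow> 'a) \<Rightarrow> ('a, 'k) tensor2 multiplier \<Rightarrow> ('a, 'k) tensor2"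
where
  "tensor_elem s = the_inv_into (tensor_space s) (tensor_emb s)"

definition flip :: "('k::field \<Rightarrow> 'a::ring \<Rightarrow> 'a) \<Rightarrow> ('a, 'k) tensor2 \<Rightarrow> ('a, 'k) tensor2" where
  "flip s = tensor_lift s (\<lambda>a b. tens s b a)"

definition flip_mult ::
  "('k::field \<Rightarrow> 'a::ring \<Rightarrow> 'a) \<Rightarrow> ('a, 'k) tensor2 multiplier \<Rightarrow> ('a, 'k) tensor2 multiplier"
where
  "flip_mult s m = (flip s \<circ> fst m \<circ> flip s, flip s \<circ> snd m \<circ> flip s)"

section \<open>Multiplier Hopf algebras\<close>

type_synonym ('a, 'k) comult = "'a \<Rightarrow> ('a, 'k) tensor2 multiplier"

text \<open>The covered elements of \<open>A \<otimes> A\<close>, named after their legs: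
  \<open>\<Delta>(a)(1 \<otimes> b)\<close>, \<open>\<Delta>(a)(b \<otimes> 1)\<close>, \<open>(1 \<otimes> b)\<Delta>(a)\<close>, \<open>(b \<otimes> 1)\<Delta>(a)\<close>.\<close>

definition cov_r2 :: "('k::field \<Rightarrow> 'a::ring \<Rightarrow> 'a) \<Rightarrow> ('a, 'k) comult \<Rightarrow> 'a \<Rightarrow> 'a \<Rightarrow> ('a, 'k) tensor2" where
  "cov_r2 s \<Delta> a b = tensor_elem s (mult_comp (\<Delta> a) (leg2 s b))"

definition cov_r1 :: "('k::field \<Rightarrow> 'a::ring \<Rightarrow> 'a) \<Rightarrow> ('a, 'k) comult \<Rightarrow> 'a \<Rightarrow> 'a \<Rightarrow> ('a, 'k) tensor2" where
  "cov_r1 s \<Delta> a b = tensor_elem s (mult_comp (\<Delta> a) (leg1 s b))"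

definition cov_l2 :: "('k::field \<Rightarrow> 'a::ring \<Rightarrow> 'a) \<Rightarrow> ('a, 'k) comult \<Rightarrow> 'a \<Rightarrow> 'a \<Rightarrow> ('a, 'k) tensor2" where
  "cov_l2 s \<Delta> b a = tensor_elem s (mult_comp (leg2 s b) (\<Delta> a))"

definition cov_l1 :: "('k::field \<Rightarrow> 'a::ring \<Rightarrow> 'a) \<Rightarrow> ('a, 'k) comult \<Rightarrow> 'a \<Rightarrow> 'a \<Rightarrow> ('a, 'k) tensor2" where
  "cov_l1 s \<Delta> b a = tensor_elem s (mult_comp (leg1 s b) (\<Delta> a))"

definition comult_hom :: "('k::field \<Rightarrow> 'a::ring \<Rightarrow> 'a) \<Rightarrow> ('a, 'k) comult \<Rightarrow> bool" where
  "comult_hom s \<Delta> \<longleftrightarrow>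
     (\<forall>a. \<Delta> a \<in> multipliers (fscale (*)) (tensor_space s) (tensor_mult s)) \<and>
     Vector_Spaces.linear s (fscale (fscale (*))) (\<lambda>a. fst (\<Delta> a)) \<and>
     Vector_Spaces.linear s (fscale (fscale (*))) (\<lambda>a. snd (\<Delta> a)) \<and>
     (\<forall>a b. \<Delta> (a * b) = mult_comp (\<Delta> a) (\<Delta> b))"

text \<open>Coassociativity is an identity in \<open>A \<otimes> A \<otimes> A\<close>: its left side is
  \<open>\<Sum> ((a \<otimes> 1)\<Delta>(p)) \<otimes> q\<close> for \<open>\<Delta>(b)(1 \<otimes> c) = \<Sum> p \<otimes> q\<close>, its right side is
  \<open>\<Sum> p \<otimes> (\<Delta>(q)(1 \<otimes> c))\<close> for \<open>(a \<otimes> 1)\<Delta>(b) = \<Sum> p \<otimes> q\<close>.\<close>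

definition coassociative :: "('k::field \<Rightarrow> 'a::ring \<Rightarrow> 'a) \<Rightarrow> ('a, 'k) comult \<Rightarrow> bool" where
  "coassociative s \<Delta> \<longleftrightarrow>
     (\<forall>a b c.
        tensor_lift s (\<lambda>p q. tensor_lift s (\<lambda>u v. tens3 s u v q) (cov_l1 s \<Delta> a p)) (cov_r2 s \<Delta> b c) =
        tensor_lift s (\<lambda>p q. tensor_lift s (\<lambda>u v. tens3 s p u v) (cov_r2 s \<Delta> q c)) (cov_l1 s \<Delta> a b))"

definition multiplier_hopf_algebra :: "('k::field \<Rightarrow> 'a::ring \<Rightarrow> 'a) \<Rightarrow> ('a, 'k) comult \<Rightarrow> bool" where
  "multiplier_hopf_algebra s \<Delta> \<longleftrightarrow>
     algebra_on s UNIV (*) \<and> nondegenerate_product (UNIV :: 'a set) (*) \<and>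
     comult_hom s \<Delta> \<and>
     (\<forall>a b. mult_comp (\<Delta> a) (leg2 s b) \<in> tensor_emb s ` tensor_space s) \<and>
     (\<forall>a b. mult_comp (leg1 s a) (\<Delta> b) \<in> tensor_emb s ` tensor_space s) \<and>
     coassociative s \<Delta> \<and>
     bij_betw (tensor_lift s (\<lambda>a b. cov_r2 s \<Delta> a b)) (tensor_space s) (tensor_space s) \<and>
     bij_betw (tensor_lift s (\<lambda>a b. cov_l1 s \<Delta> a b)) (tensor_space s) (tensor_space s)"

definition regular_multiplier_hopf_algebra ::
  "('k::field \<Rightarrow> 'a::ring \<Rightarrow> 'a) \<Rightarrow> ('a, 'k) comult \<Rightarrow> bool"
where
  "regular_multiplier_hopf_algebra s \<Delta> \<longleftrightarrow>
     multiplier_hopf_algebra s \<Delta> \<and> multiplier_hopf_algebra s (\<lambda>a. flip_mult s (\<Delta> a))"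

definition is_counit :: "('k::field \<Rightarrow> 'a::ring \<Rightarrow> 'a) \<Rightarrow> ('a, 'k) comult \<Rightarrow> ('a \<Rightarrow> 'k) \<Rightarrow> bool" where
  "is_counit s \<Delta> \<epsilon> \<longleftrightarrow>
     Vector_Spaces.linear s (*) \<epsilon> \<and>
     (\<forall>a b. tensor_lift s (\<lambda>p q. s (\<epsilon> p) q) (cov_r2 s \<Delta> a b) = a * b) \<and>
     (\<forall>a b. tensor_lift s (\<lambda>p q. s (\<epsilon> q) p) (cov_l1 s \<Delta> a b) = a * b)"

definition counit :: "('k::field \<Rightarrow> 'a::ring \<Rightarrow> 'a) \<Rightarrow> ('a, 'k) comult \<Rightarrow> 'a \<Rightarrow> 'k" where
  "counit s \<Delta> = (THE \<epsilon>. is_counit s \<Delta> \<epsilon>)"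

text \<open>In the regular case the antipode takes values in \<open>A\<close> and is bijective; only this case is used.\<close>

definition is_antipode :: "('k::field \<Rightarrow> 'a::ring \<Rightarrow> 'a) \<Rightarrow> ('a, 'k) comult \<Rightarrow> ('a \<Rightarrow> 'a) \<Rightarrow> bool" where
  "is_antipode s \<Delta> S \<longleftrightarrow>
     Vector_Spaces.linear s s S \<and>
     (\<forall>a b. tensor_lift s (\<lambda>p q. S p * q) (cov_r2 s \<Delta> a b) = s (counit s \<Delta> a) b) \<and>
     (\<forall>a b. tensor_lift s (\<lambda>p q. p * S q) (cov_l1 s \<Delta> a b) = s (counit s \<Delta> b) a)"

definition antipode :: "('k::field \<Rightarrow> 'a::ring \<Rightarrow> 'a) \<Rightarrow> ('a, 'k) comult \<Rightarrow> 'a \<Rightarrow> 'a" where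
  "antipode s \<Delta> = (THE S. is_antipode s \<Delta> S)"

text \<open>\<open>a\<^sub>1 \<otimes> S(a\<^sub>2)b = (\<iota> \<otimes> S)((1 \<otimes> S\<inverse>(b))\<Delta>(a))\<close> and
  \<open>S\<inverse>(a\<^sub>1)b \<otimes> a\<^sub>2 = (S\<inverse> \<otimes> \<iota>)((S(b) \<otimes> 1)\<Delta>(a))\<close>, since \<open>S\<close> is a bijective anti-homomorphism.\<close>

definition cov_S :: "('k::field \<Rightarrow> 'a::ring \<Rightarrow> 'a) \<Rightarrow> ('a, 'k) comult \<Rightarrow> 'a \<Rightarrow> 'a \<Rightarrow> ('a, 'k) tensor2" where
  "cov_S s \<Delta> a b =
     tensor_lift s (\<lambda>p q. tens s p (antipode s \<Delta> q)) (cov_l2 s \<Delta> (inv (antipode s \<Delta>) b) a)"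

definition cov_Sinv :: "('k::field \<Rightarrow> 'a::ring \<Rightarrow> 'a) \<Rightarrow> ('a, 'k) comult \<Rightarrow> 'a \<Rightarrow> 'a \<Rightarrow> ('a, 'k) tensor2" where
  "cov_Sinv s \<Delta> a b =
     tensor_lift s (\<lambda>p q. tens s (inv (antipode s \<Delta>) p) q) (cov_l1 s \<Delta> (antipode s \<Delta> b) a)"

section \<open>Global and partial module algebras\<close>

text \<open>Linear maps out of \<open>A \<otimes> R\<close> are given as bilinear maps. The span below is the
  image of such a map on \<open>A \<otimes> X\<close>.\<close>

definition act_span ::
  "('k::field \<Rightarrow> 'r::ab_group_add \<Rightarrow> 'r) \<Rightarrow> ('a \<Rightarrow> 'r \<Rightarrow> 'r) \<Rightarrow> 'r set \<Rightarrow> 'r set"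
where
  "act_span s act X = module.span s {act a x |a x. x \<in> X}"

definition module_algebra ::
  "('k::field \<Rightarrow> 'a::ring \<Rightarrow> 'a) \<Rightarrow> ('a, 'k) comult \<Rightarrow>
   ('k \<Rightarrow> 'r::ab_group_add \<Rightarrow> 'r) \<Rightarrow> 'r set \<Rightarrow> ('r \<Rightarrow> 'r \<Rightarrow> 'r) \<Rightarrow> ('a \<Rightarrow> 'r \<Rightarrow> 'r) \<Rightarrow> bool"
where
  "module_algebra sA \<Delta> sR R mR act \<longleftrightarrow>
     algebra_on sR R mR \<and> nondegenerate_product R mR \<and>
     bilinear_on sA sR sR UNIV R R act \<and>
     act_span sR act R = R \<and>
     (\<forall>a b. \<forall>x\<in>R. act a (act b x) = act (a * b) x) \<and>
     (\<forall>a e. \<forall>x\<in>R. \<forall>y\<in>R. act e y = y \<longrightarrow>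
        act a (mR x y) = tensor_lift sA (\<lambda>p q. mR (act p x) (act q y)) (cov_r2 sA \<Delta> a e))"

definition symmetric_partial_module_algebra ::
  "('k::field \<Rightarrow> 'a::ring \<Rightarrow> 'a) \<Rightarrow> ('a, 'k) comult \<Rightarrow>
   ('k \<Rightarrow> 'l::ring \<Rightarrow> 'l) \<Rightarrow> ('a \<Rightarrow> 'l \<Rightarrow> 'l) \<Rightarrow> ('a \<Rightarrow> 'l multiplier) \<Rightarrow> bool"
where
  "symmetric_partial_module_algebra sA \<Delta> sL dot e \<longleftrightarrow>
     algebra_on sL UNIV (*) \<and> nondegenerate_product (UNIV :: 'l set) (*) \<and>
     bilinear_on sA sL sL UNIV UNIV UNIV dot \<and>
     (\<forall>a. e a \<in> multipliers sL UNIV (*)) \<and>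
     Vector_Spaces.linear sA (fscale sL) (\<lambda>a. fst (e a)) \<and>
     Vector_Spaces.linear sA (fscale sL) (\<lambda>a. snd (e a)) \<and>
     (\<forall>a b x y. dot a (x * dot b y) =
        tensor_lift sA (\<lambda>p q. dot p x * dot q y) (cov_r2 sA \<Delta> a b)) \<and>
     (\<forall>a b x. fst (e a) (dot b x) = tensor_lift sA (\<lambda>p q. dot p (dot q x)) (cov_S sA \<Delta> a b)) \<and>
     (\<forall>a x. fst (e a) x \<in> act_span sL dot UNIV) \<and>
     (\<forall>F X. finite F \<longrightarrow> finite X \<longrightarrow>
        (\<exists>b. \<forall>a\<in>F. a * b = a \<and> b * a = a \<and> (\<forall>x\<in>X. dot a x = dot a (dot b x)))) \<and>
     (\<forall>x. (\<forall>a. dot a x = 0) \<longleftrightarrow> x = 0) \<and>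
     (\<forall>a b x y. dot a (dot b x * y) =
        tensor_lift sA (\<lambda>p q. dot p x * dot q y) (cov_r1 sA \<Delta> a b)) \<and>
     (\<forall>a b x. snd (e a) (dot b x) = tensor_lift sA (\<lambda>p q. dot q (dot p x)) (cov_Sinv sA \<Delta> a b)) \<and>
     (\<forall>a x. snd (e a) x \<in> act_span sL dot UNIV)"

definition quasi_unitary :: "('a::times \<Rightarrow> 'l \<Rightarrow> 'l) \<Rightarrow> bool" where
  "quasi_unitary dot \<longleftrightarrow>
     (\<forall>X. finite X \<longrightarrow> (\<exists>b. \<forall>x\<in>X. dot b x = x \<and> (\<forall>a. dot (a * b) x = dot a x)))"

section \<open>Globalizations\<close>

definition symmetric_projection ::
  "('k::field \<Rightarrow> 'r::ab_group_add \<Rightarrow> 'r) \<Rightarrow> 'r set \<Rightarrow> ('r \<Rightarrow> 'r \<Rightarrow> 'r) \<Rightarrow> ('a \<Rightarrow> 'r \<Rightarrow> 'r) \<Rightarrow>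
   'r set \<Rightarrow> ('r \<Rightarrow> 'r) \<Rightarrow> bool"
where
  "symmetric_projection sR R mR act N \<pi> \<longleftrightarrow>
     N \<subseteq> R \<and> algebra_on sR N mR \<and> nondegenerate_product N mR \<and>
     linear_on sR sR R R \<pi> \<and> (\<forall>x\<in>R. \<forall>y\<in>R. \<pi> (mR x y) = mR (\<pi> x) (\<pi> y)) \<and>
     \<pi> ` R = N \<and> (\<forall>x\<in>N. \<pi> x = x) \<and>
     (\<forall>a b. \<forall>x\<in>N. \<forall>y\<in>N. \<pi> (act a (mR x (act b y))) = \<pi> (act a (mR x (\<pi> (act b y))))) \<and>
     (\<forall>a b. \<forall>x\<in>N. \<forall>y\<in>N. \<pi> (act a (mR (act b x) y)) = \<pi> (act a (mR (\<pi> (act b x)) y)))"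

definition globalization ::
  "('k::field \<Rightarrow> 'a::ring \<Rightarrow> 'a) \<Rightarrow> ('a, 'k) comult \<Rightarrow>
   ('k \<Rightarrow> 'l::ring \<Rightarrow> 'l) \<Rightarrow> ('a \<Rightarrow> 'l \<Rightarrow> 'l) \<Rightarrow>
   ('k \<Rightarrow> 'r::ab_group_add \<Rightarrow> 'r) \<Rightarrow> 'r set \<Rightarrow> ('r \<Rightarrow> 'r \<Rightarrow> 'r) \<Rightarrow> ('a \<Rightarrow> 'r \<Rightarrow> 'r) \<Rightarrow>
   ('l \<Rightarrow> 'r) \<Rightarrow> ('r \<Rightarrow> 'r) \<Rightarrow> bool"
where
  "globalization sA \<Delta> sL dot sR R mR act \<theta> \<pi> \<longleftrightarrow>
     module_algebra sA \<Delta> sR R mR act \<and>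
     linear_on sL sR UNIV R \<theta> \<and> (\<forall>x y. \<theta> (x * y) = mR (\<theta> x) (\<theta> y)) \<and> inj \<theta> \<and>
     (\<forall>r\<in>R. \<forall>x. mR r (\<theta> x) \<in> range \<theta> \<and> mR (\<theta> x) r \<in> range \<theta>) \<and>
     symmetric_projection sR R mR act (range \<theta>) \<pi> \<and>
     (\<forall>a x. \<theta> (dot a x) = \<pi> (act a (\<theta> x))) \<and>
     R = act_span sR act (range \<theta>)"

section \<open>The standard construction\<close>

text \<open>\<open>rshift f a\<close> is the map \<open>f(_ a)\<close>.\<close>

definition rshift :: "('a::times \<Rightarrow> 'l) \<Rightarrow> 'a \<Rightarrow> 'a \<Rightarrow> 'l" where
  "rshift f a = (\<lambda>c. f (c * a))"

definition hom_r ::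
  "('k::field \<Rightarrow> 'a::ring \<Rightarrow> 'a) \<Rightarrow> ('k \<Rightarrow> 'l::ring \<Rightarrow> 'l) \<Rightarrow> ('a \<Rightarrow> 'l) set"
where
  "hom_r sA sL = module.span (fscale sL) {rshift f a |f a. Vector_Spaces.linear sA sL f}"

text \<open>Every element of \<open>hom_r sA sL\<close> is a single \<open>rshift f a\<close>, and the results below do not depend
  on this presentation. The element \<open>c\<^sub>1 a \<otimes> c\<^sub>2 b\<close> is \<open>\<Delta>(c)(a \<otimes> b)\<close>.\<close>

definition hom_r_mult ::
  "('k::field \<Rightarrow> 'a::ring \<Rightarrow> 'a) \<Rightarrow> ('a, 'k) comult \<Rightarrow> ('k \<Rightarrow> 'l::ring \<Rightarrow> 'l) \<Rightarrow>
   ('a \<Rightarrow> 'l) \<Rightarrow> ('a \<Rightarrow> 'l) \<Rightarrow> 'a \<Rightarrow> 'l"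
where
  "hom_r_mult sA \<Delta> sL h k =
     (THE m. \<exists>f a g b. Vector_Spaces.linear sA sL f \<and> Vector_Spaces.linear sA sL g \<and>
        h = rshift f a \<and> k = rshift g b \<and>
        m = (\<lambda>c. tensor_lift sA (\<lambda>p q. f p * g q) (fst (\<Delta> c) (tens sA a b))))"

definition hom_r_act :: "'a::ring \<Rightarrow> ('a \<Rightarrow> 'l) \<Rightarrow> 'a \<Rightarrow> 'l" where
  "hom_r_act a h = rshift h a"

lemma hom_r_act_rshift: "hom_r_act a (rshift f b) = rshift f (a * b)"
  by (simp add: hom_r_act_def rshift_def mult.assoc)

definition phi :: "('a \<Rightarrow> 'l \<Rightarrow> 'l) \<Rightarrow> 'l \<Rightarrow> 'a \<Rightarrow> 'l" where
  "phi dot x = (\<lambda>a. dot a x)"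

definition pi' ::
  "('k::field \<Rightarrow> 'a::ring \<Rightarrow> 'a) \<Rightarrow> ('k \<Rightarrow> 'l::ring \<Rightarrow> 'l) \<Rightarrow> ('a \<Rightarrow> 'l \<Rightarrow> 'l) \<Rightarrow>
   ('a \<Rightarrow> 'l) \<Rightarrow> 'a \<Rightarrow> 'l"
where
  "pi' sA sL dot h =
     (THE k. \<exists>f a. Vector_Spaces.linear sA sL f \<and> h = rshift f a \<and> k = phi dot (f a))"

end

theory Submission
  imports Defs
begin

text \<open>
  For \<open>h = a \<triangleright> \<phi>(x)\<close> and \<open>k = b \<triangleright> \<phi>(y)\<close>, write \<open>a \<otimes> b = \<Sum> \<Delta>(a\<^sub>i)(1 \<otimes> b\<^sub>i)\<close>, which is possible because
  the canonical map is onto. The axiom \<open>a \<cdot> (x(b \<cdot> y)) = (a\<^sub>1 \<cdot> x)(a\<^sub>2b \<cdot> y)\<close> says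
  \<open>\<phi>(x)(b \<triangleright> \<phi>(y)) = \<phi>(x(b \<cdot> y))\<close>, so that \<open>hk = \<Sum> a\<^sub>i \<triangleright> \<phi>(x(b\<^sub>i \<cdot> y))\<close> lies in \<open>R\<close> and
  \<open>\<pi>(hk) = \<phi>((a \<cdot> x)(b \<cdot> y)) = \<pi>(h)\<pi>(k)\<close>. The mirrored axiom makes \<open>\<phi>(L)\<close> a two-sided ideal.
  If \<open>hR = 0\<close>, surjectivity of the canonical map turns \<open>h(c\<^sub>1)(c\<^sub>2b \<cdot> y) = 0\<close> into \<open>h(p)(q \<cdot> y) = 0\<close> for all
  \<open>p, q, y\<close>, and \<open>h = 0\<close> because \<open>L = A \<cdot> L\<close> has a nondegenerate product; regularity gives the other side.
  The local units of \<open>A\<close> are read off from the axioms of the partial action.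
\<close>

text \<open>Induction leaves eta-expanded tensors in the goal, which the pointwise rules would take apart.\<close>

declare plus_fun_apply [simp del] zero_fun_apply [simp del]

section \<open>Linear and bilinear maps\<close>

abbreviation bilinear_map ::
  "('k::field \<Rightarrow> 'a::ab_group_add \<Rightarrow> 'a) \<Rightarrow> ('k \<Rightarrow> 'w::ab_group_add \<Rightarrow> 'w) \<Rightarrow> ('a \<Rightarrow> 'a \<Rightarrow> 'w) \<Rightarrow> bool"
where
  "bilinear_map s w f \<equiv> bilinear_on s s w UNIV UNIV UNIV f"

lemma bilinear_map_iff:
  "bilinear_map s w f \<longleftrightarrow>
     (\<forall>x y z. f (x + y) z = f x z + f y z) \<and> (\<forall>x y z. f x (y + z) = f x y + f x z) \<and>
     (\<forall>c x y. f (s c x) y = w c (f x y)) \<and> (\<forall>c x y. f x (s c y) = w c (f x y))"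
  by (auto simp: bilinear_on_def linear_on_def)

text \<open>The shape copies the test inside \<open>tens3\<close>, so that evaluating
  \<open>tens3\<close> at a scalar trilinear form needs no rearrangement.\<close>

definition trilinear_map ::
  "('k::field \<Rightarrow> 'a::ab_group_add \<Rightarrow> 'a) \<Rightarrow> ('k \<Rightarrow> 'w::ab_group_add \<Rightarrow> 'w) \<Rightarrow> ('a \<Rightarrow> 'a \<Rightarrow> 'a \<Rightarrow> 'w) \<Rightarrow> bool"
where
  "trilinear_map s w \<tau> \<longleftrightarrow>
     (\<forall>x. bilinear_map s w (\<tau> x)) \<and> (\<forall>y z. linear_on s w UNIV UNIV (\<lambda>x. \<tau> x y z))"

lemma vector_space_field: "vector_space ((*) :: 'k::field \<Rightarrow> 'k \<Rightarrow> 'k)"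
  by unfold_locales (simp_all add: algebra_simps)

lemma vector_space_fscale: "vector_space w \<Longrightarrow> vector_space (fscale w)"
  by (simp add: vector_space_def fscale_def fun_eq_iff plus_fun_apply)

lemma linear_iff:
  assumes "vector_space s" "vector_space w"
  shows "Vector_Spaces.linear s w f \<longleftrightarrow>
    (\<forall>x y. f (x + y) = f x + f y) \<and> (\<forall>c x. f (s c x) = w c (f x))"
  using assms
  by (auto simp: Vector_Spaces.linear_def module_hom_def module_hom_axioms_def
      module_iff_vector_space)

lemma linear_evaluation:
  assumes "vector_space w"
  shows "Vector_Spaces.linear (fscale w) w (\<lambda>f. f x)"
  by (simp add: linear_iff[OF vector_space_fscale[OF assms] assms] fscale_def plus_fun_apply)

text \<open>A nonzero vector is independent on its own, so sending it to 1 extends to a functional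
  on the whole space.\<close>

lemma separating_functional:
  fixes w :: "'k::field \<Rightarrow> 'w::ab_group_add \<Rightarrow> 'w"
  assumes "vector_space w" "x \<noteq> 0"
  obtains \<xi> where "Vector_Spaces.linear w (*) \<xi>" "\<xi> x \<noteq> (0::'k)"
proof -
  interpret V: vector_space w by fact
  interpret P: vector_space_pair w "(*) :: 'k \<Rightarrow> 'k \<Rightarrow> 'k"
    using assms(1) vector_space_field by (rule vector_space_pair.intro)
  have "V.independent {x}"
    using assms(2) by simp
  then obtain g where "Vector_Spaces.linear w (*) g" "\<forall>y\<in>{x}. g y = (1::'k)"
    using P.linear_independent_extend[of "{x}" "\<lambda>_. 1"] by blast
  then show thesis using that[of g] by simp
qed

text \<open>Separation is applied to the difference. This transfers identities about scalar forms,
  which is what tensors see, to values in any vector space.\<close>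

lemma eq_if_functionals_eq:
  fixes w :: "'k::field \<Rightarrow> 'w::ab_group_add \<Rightarrow> 'w"
  assumes "vector_space w"
    and eq: "\<And>\<xi>. Vector_Spaces.linear w (*) \<xi> \<Longrightarrow> \<xi> x = (\<xi> y :: 'k)"
  shows "x = y"
proof (rule ccontr)
  assume "x \<noteq> y"
  then obtain \<xi> :: "'w \<Rightarrow> 'k" where l: "Vector_Spaces.linear w (*) \<xi>" "\<xi> (x - y) \<noteq> 0"
    using separating_functional[OF assms(1), of "x - y"] by auto
  interpret l: Vector_Spaces.linear w "(*)" \<xi> by fact
  show False using l(2) eq[OF l(1)] by (simp add: l.diff)
qed

section \<open>The universal property of the tensor square\<close>

abbreviation sum_tens :: "('k::field \<Rightarrow> 'a::ab_group_add \<Rightarrow> 'a) \<Rightarrow> ('a \<times> 'a) list \<Rightarrow> ('a, 'k) tensor2" where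
  "sum_tens s ps \<equiv> (\<Sum>(a, b)\<leftarrow>ps. tens s a b)"

locale tensor_square = vector_space s for s :: "'k::field \<Rightarrow> 'a::ab_group_add \<Rightarrow> 'a"
begin

lemma vector_space_tensor: "vector_space (fscale (*) :: 'k \<Rightarrow> ('a, 'k) tensor2 \<Rightarrow> ('a, 'k) tensor2)"
  by (rule vector_space_fscale[OF vector_space_field])

interpretation T: vector_space "fscale (*) :: 'k \<Rightarrow> ('a, 'k) tensor2 \<Rightarrow> ('a, 'k) tensor2"
  by (rule vector_space_tensor)

lemma bilinear_tens: "bilinear_map s (fscale (*)) (tens s)"
  by (auto simp: bilinear_map_iff tens_def fscale_def fun_eq_iff plus_fun_apply)

lemma tens_add_left: "tens s (a + b) c = tens s a c + tens s b c"
  and tens_add_right: "tens s a (b + c) = tens s a b + tens s a c"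
  and tens_scale_left: "tens s (s k a) b = fscale (*) k (tens s a b)"
  and tens_scale_right: "tens s a (s k b) = fscale (*) k (tens s a b)"
  using bilinear_tens by (auto simp: bilinear_map_iff)

lemma tens_in_space [simp]: "tens s a b \<in> tensor_space s"
  unfolding tensor_space_def by (rule T.span_base) auto

lemma space_add [simp]: "t \<in> tensor_space s \<Longrightarrow> u \<in> tensor_space s \<Longrightarrow> t + u \<in> tensor_space s"
  and space_zero [simp]: "0 \<in> tensor_space s"
  and space_scale [simp]: "t \<in> tensor_space s \<Longrightarrow> fscale (*) k t \<in> tensor_space s"
  unfolding tensor_space_def by (auto intro: T.span_add T.span_zero T.span_scale)

lemma scale_sum_tens:
  "fscale (*) k (sum_tens s ps) = sum_tens s (map (\<lambda>(a, b). (s k a, b)) ps)"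
  by (induction ps) (auto simp: tens_scale_left T.scale_right_distrib split: prod.splits)

text \<open>Scalars are absorbed into the left leg, so lists of pairs describe the whole span. These
  are the presentations that \<open>tensor_lift\<close> quantifies over.\<close>

lemma in_tensor_space_iff: "t \<in> tensor_space s \<longleftrightarrow> (\<exists>ps. t = sum_tens s ps)"
proof
  assume "t \<in> tensor_space s"
  then have "t \<in> T.span {tens s a b |a b. True}" by (simp add: tensor_space_def)
  then show "\<exists>ps. t = sum_tens s ps"
  proof (induction rule: T.span_induct_alt)
    case base
    show ?case by (rule exI[of _ "[]"]) simp
  next
    case (step k x y)
    then obtain a b ps where "x = tens s a b" "y = sum_tens s ps" by auto
    then have "fscale (*) k x + y = sum_tens s ((s k a, b) # ps)"
      by (simp add: tens_scale_left)
    then show ?case by blast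
  qed
next
  assume "\<exists>ps. t = sum_tens s ps"
  then obtain ps where "t = sum_tens s ps" ..
  moreover have "sum_tens s ps \<in> tensor_space s" by (induction ps) auto
  ultimately show "t \<in> tensor_space s" by simp
qed

lemma sum_tens_in_space [simp]: "sum_tens s ps \<in> tensor_space s"
  using in_tensor_space_iff by blast

lemma tensor_space_cases:
  assumes "t \<in> tensor_space s"
  obtains ps where "t = sum_tens s ps"
  using assms in_tensor_space_iff by blast

lemma tensor_space_induct [consumes 1, case_names zero tens add]:
  assumes "t \<in> tensor_space s"
    and "P 0" and "\<And>a b. P (tens s a b)"
    and "\<And>t u. t \<in> tensor_space s \<Longrightarrow> u \<in> tensor_space s \<Longrightarrow> P t \<Longrightarrow> P u \<Longrightarrow> P (t + u)"
  shows "P t"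
proof -
  obtain ps where "t = sum_tens s ps" using assms(1) by (rule tensor_space_cases)
  moreover have "P (sum_tens s ps)" by (induction ps) (auto intro: assms(2-4))
  ultimately show ?thesis by simp
qed

text \<open>Linear functionals reduce a bilinear map into an arbitrary space to bilinear forms.\<close>

lemma sum_tens_eq_imp:
  assumes "vector_space w" "bilinear_map s w f" "sum_tens s ps = sum_tens s qs"
  shows "(\<Sum>(a, b)\<leftarrow>ps. f a b) = (\<Sum>(a, b)\<leftarrow>qs. f a b)"
proof (rule eq_if_functionals_eq[OF assms(1)])
  fix \<xi> :: "'b \<Rightarrow> 'k" assume "Vector_Spaces.linear w (*) \<xi>"
  then interpret l: Vector_Spaces.linear w "(*)" \<xi> .
  let ?b = "\<lambda>a b. \<xi> (f a b)"
  have "bilinear_map s (*) ?b"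
    using assms(2) by (simp add: bilinear_map_iff l.add l.scale)
  then have "sum_tens s rs ?b = \<xi> (\<Sum>(a, b)\<leftarrow>rs. f a b)" for rs
    by (induction rs) (auto simp: l.add tens_def plus_fun_apply zero_fun_apply)
  then show "\<xi> (\<Sum>(a, b)\<leftarrow>ps. f a b) = \<xi> (\<Sum>(a, b)\<leftarrow>qs. f a b)"
    using assms(3) by metis
qed

text \<open>By \<open>sum_tens_eq_imp\<close> the candidate value is the same for all presentations
  of the tensor, so the definite description denotes it.\<close>

lemma lift_sum_tens:
  assumes "vector_space w" "bilinear_map s w f"
  shows "tensor_lift s f (sum_tens s ps) = (\<Sum>(a, b)\<leftarrow>ps. f a b)"
proof -
  have "(THE v. \<exists>qs. sum_tens s ps = sum_tens s qs \<and> v = (\<Sum>(a, b)\<leftarrow>qs. f a b)) =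
      (\<Sum>(a, b)\<leftarrow>ps. f a b)"
    by (rule the_equality) (auto dest: sum_tens_eq_imp[OF assms])
  then show ?thesis by (simp add: tensor_lift_def)
qed

lemma lift_tens:
  assumes "vector_space w" "bilinear_map s w f"
  shows "tensor_lift s f (tens s a b) = f a b"
  using lift_sum_tens[OF assms, of "[(a, b)]"] by simp

lemma lift_zero:
  assumes "vector_space w" "bilinear_map s w f"
  shows "tensor_lift s f 0 = 0"
  using lift_sum_tens[OF assms, of "[]"] by simp

lemma lift_add:
  assumes "vector_space w" "bilinear_map s w f" "t \<in> tensor_space s" "u \<in> tensor_space s"
  shows "tensor_lift s f (t + u) = tensor_lift s f t + tensor_lift s f u"
proof -
  obtain ps qs where "t = sum_tens s ps" "u = sum_tens s qs"
    using assms(3,4) tensor_space_cases by metis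
  moreover have "tensor_lift s f (sum_tens s (ps @ qs)) =
      tensor_lift s f (sum_tens s ps) + tensor_lift s f (sum_tens s qs)"
    by (simp only: lift_sum_tens[OF assms(1,2)]) simp
  ultimately show ?thesis by simp
qed

lemma lift_scale:
  assumes "vector_space w" "bilinear_map s w f" "t \<in> tensor_space s"
  shows "tensor_lift s f (fscale (*) k t) = w k (tensor_lift s f t)"
proof -
  interpret W: vector_space w by fact
  obtain ps where t: "t = sum_tens s ps" using assms(3) by (rule tensor_space_cases)
  have "(\<Sum>(a, b)\<leftarrow>map (\<lambda>(a, b). (s k a, b)) ps. f a b) = w k (\<Sum>(a, b)\<leftarrow>ps. f a b)"
    using assms(2) by (induction ps) (auto simp: bilinear_map_iff W.scale_right_distrib)
  then show ?thesis
    by (simp only: t scale_sum_tens lift_sum_tens[OF assms(1,2)])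
qed

lemma lift_in_subspace:
  assumes "vector_space w" "bilinear_map s w f" "t \<in> tensor_space s"
    and "module.subspace w V" "\<And>a b. f a b \<in> V"
  shows "tensor_lift s f t \<in> V"
proof -
  interpret W: vector_space w by fact
  show ?thesis
    using assms(3)
    by (induction rule: tensor_space_induct)
      (simp_all add: lift_zero[OF assms(1,2)] lift_tens[OF assms(1,2)] lift_add[OF assms(1,2)]
        W.subspace_0[OF assms(4)] W.subspace_add[OF assms(4)] assms(5))
qed

text \<open>Linearity of \<open>G\<close> is asked only on a subspace containing the values of
  \<open>f\<close>, because maps extended by zero, such as \<open>tensor_lift s f\<close>, need be
  linear only on the tensor space.\<close>

lemma lift_comp:
  assumes "vector_space w" "bilinear_map s w f"
    and "vector_space w'" "linear_on w w' V UNIV G"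
    and "module.subspace w V" "\<And>a b. f a b \<in> V" "t \<in> tensor_space s"
  shows "tensor_lift s (\<lambda>a b. G (f a b)) t = G (tensor_lift s f t)"
proof -
  interpret W: vector_space w by fact
  interpret W': vector_space w' by fact
  have G: "x \<in> V \<Longrightarrow> y \<in> V \<Longrightarrow> G (x + y) = G x + G y" "x \<in> V \<Longrightarrow> G (w c x) = w' c (G x)" for x y c
    using assms(4) by (auto simp: linear_on_def)
  have G0: "G 0 = 0"
    using G(2)[of 0 0] W.subspace_0[OF assms(5)] by simp
  have Gf: "bilinear_map s w' (\<lambda>a b. G (f a b))"
    using assms(2,6) by (simp add: bilinear_map_iff G)
  show ?thesis
    using assms(7)
    by (induction rule: tensor_space_induct)
      (simp_all add: lift_zero[OF assms(1,2)] lift_tens[OF assms(1,2)] lift_add[OF assms(1,2)]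
        lift_zero[OF assms(3) Gf] lift_tens[OF assms(3) Gf] lift_add[OF assms(3) Gf]
        G G0 lift_in_subspace[OF assms(1,2) _ assms(5,6)])
qed

lemma lift_comp_linear:
  assumes "bilinear_map s w f" "Vector_Spaces.linear w w' G" "t \<in> tensor_space s"
  shows "tensor_lift s (\<lambda>a b. G (f a b)) t = G (tensor_lift s f t)"
proof -
  interpret G: Vector_Spaces.linear w w' G by fact
  show ?thesis
    by (rule lift_comp[OF G.vs1.vector_space_axioms assms(1) G.vs2.vector_space_axioms, of UNIV])
      (auto simp: linear_on_def G.add G.scale assms(3))
qed

lemma subspace_tensor_space: "T.subspace (tensor_space s)"
  by (rule T.subspaceI) auto

lemma lift_comp_lift:
  assumes "vector_space w" "bilinear_map s w f" "t \<in> tensor_space s"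
    and "bilinear_map s (fscale (*)) g" "\<And>a b. g a b \<in> tensor_space s"
  shows "tensor_lift s f (tensor_lift s g t) = tensor_lift s (\<lambda>a b. tensor_lift s f (g a b)) t"
  using lift_comp[OF vector_space_tensor assms(4,1) _ subspace_tensor_space assms(5,3),
      of "tensor_lift s f"]
  by (simp add: linear_on_def lift_add[OF assms(1,2)] lift_scale[OF assms(1,2)])

lemma lift_lift_tens:
  assumes "vector_space w" "bilinear_map s w f" "t \<in> tensor_space s"
    and "bilinear_map s (fscale (*)) (\<lambda>a b. tens s (g a b) (h a b))"
  shows "tensor_lift s f (tensor_lift s (\<lambda>a b. tens s (g a b) (h a b)) t) =
    tensor_lift s (\<lambda>a b. f (g a b) (h a b)) t"
  using lift_comp_lift[OF assms] by (simp add: lift_tens[OF assms(1,2)])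

lemma lift_tens_id: "t \<in> tensor_space s \<Longrightarrow> tensor_lift s (tens s) t = t"
  by (induction rule: tensor_space_induct)
    (simp_all add: lift_zero[OF vector_space_tensor bilinear_tens]
      lift_tens[OF vector_space_tensor bilinear_tens]
      lift_add[OF vector_space_tensor bilinear_tens])

lemma lift_add_fun:
  assumes "vector_space w" "bilinear_map s w f" "bilinear_map s w g" "t \<in> tensor_space s"
  shows "tensor_lift s (\<lambda>a b. f a b + g a b) t = tensor_lift s f t + tensor_lift s g t"
proof -
  have fg: "bilinear_map s w (\<lambda>a b. f a b + g a b)"
  proof -
    interpret W: vector_space w by fact
    show ?thesis using assms(2,3) by (simp add: bilinear_map_iff W.scale_right_distrib)
  qed
  show ?thesis
    using assms(4)
    by (induction rule: tensor_space_induct)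
      (simp_all add: lift_zero[OF assms(1)] lift_tens[OF assms(1)] lift_add[OF assms(1)] assms(2,3) fg)
qed

lemma lift_scale_fun:
  assumes "vector_space w" "bilinear_map s w f" "t \<in> tensor_space s"
  shows "tensor_lift s (\<lambda>a b. w k (f a b)) t = w k (tensor_lift s f t)"
proof -
  interpret W: vector_space w by fact
  have "Vector_Spaces.linear w w (w k)"
    by (simp add: linear_iff[OF assms(1,1)] W.scale_right_distrib W.scale_left_commute)
  then show ?thesis using lift_comp_linear assms by blast
qed

text \<open>In coassociativity a covered product \<open>C p\<close> is a tensor depending on a leg
  \<open>p\<close> of another tensor. The rules for the outer lift need this bilinearity.\<close>

lemma bilinear_lift_left:
  assumes w: "vector_space w" and \<tau>: "trilinear_map s w \<tau>"
    and C: "linear_on s (fscale (*)) UNIV (tensor_space s) C"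
  shows "bilinear_map s w (\<lambda>p q. tensor_lift s (\<lambda>u v. \<tau> u v q) (C p))"
proof -
  have b: "bilinear_map s w (\<lambda>u v. \<tau> u v q)" for q
    using \<tau> by (simp add: trilinear_map_def bilinear_map_iff linear_on_def)
  have \<tau>': "\<tau> u v (x + y) = \<tau> u v x + \<tau> u v y" "\<tau> u v (s c x) = w c (\<tau> u v x)" for u v x y c
    using \<tau> by (auto simp: trilinear_map_def bilinear_map_iff)
  have C': "C p \<in> tensor_space s" "C (p + q) = C p + C q" "C (s k p) = fscale (*) k (C p)" for p q k
    using C by (auto simp: linear_on_def)
  show ?thesis
    by (simp add: bilinear_map_iff C' \<tau>' lift_add[OF w b] lift_scale[OF w b]
        lift_add_fun[OF w b b] lift_scale_fun[OF w b])
qed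

lemma bilinear_lift_right:
  assumes w: "vector_space w" and \<tau>: "trilinear_map s w \<tau>"
    and C: "linear_on s (fscale (*)) UNIV (tensor_space s) C"
  shows "bilinear_map s w (\<lambda>p q. tensor_lift s (\<tau> p) (C q))"
proof -
  have b: "bilinear_map s w (\<tau> p)" for p
    using \<tau> by (simp add: trilinear_map_def)
  have \<tau>': "\<tau> (x + y) = (\<lambda>u v. \<tau> x u v + \<tau> y u v)" "\<tau> (s c x) = (\<lambda>u v. w c (\<tau> x u v))" for x y c
    using \<tau> by (auto simp: trilinear_map_def linear_on_def fun_eq_iff)
  have C': "C p \<in> tensor_space s" "C (p + q) = C p + C q" "C (s k p) = fscale (*) k (C p)" for p q k
    using C by (auto simp: linear_on_def)
  show ?thesis
    by (simp add: bilinear_map_iff C' \<tau>' lift_add[OF w b] lift_scale[OF w b]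
        lift_add_fun[OF w b b] lift_scale_fun[OF w b])
qed

section \<open>Threefold tensors as functionals on trilinear forms\<close>

lemma trilinear_tens3: "trilinear_map s (fscale (*)) (tens3 s)"
  by (auto simp: trilinear_map_def bilinear_map_iff linear_on_def tens3_def fscale_def fun_eq_iff
      plus_fun_apply)

lemma tens3_eval: "trilinear_map s (*) \<tau> \<Longrightarrow> tens3 s a b c \<tau> = \<tau> a b c"
  by (simp add: tens3_def trilinear_map_def)

end

section \<open>Algebras with local units\<close>

text \<open>A two-sided unit shared by a finite set of elements stands in for the missing 1 in the
  arguments below.\<close>

locale local_unit_algebra = tensor_square s for s :: "'k::field \<Rightarrow> 'a::ring \<Rightarrow> 'a" +
  assumes mult_scale_left: "s c x * y = s c (x * y)"
    and mult_scale_right: "x * s c y = s c (x * y)"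
    and local_unit: "finite (F :: 'a set) \<Longrightarrow> \<exists>z. \<forall>x\<in>F. x * z = x \<and> z * x = x"
begin

lemmas tens_simps = tens_add_left tens_add_right tens_scale_left tens_scale_right
  mult_scale_left mult_scale_right distrib_left distrib_right

lemma bilinear_precomp:
  assumes "bilinear_map s w f"
  shows "bilinear_map s w (\<lambda>p q. f (a * p) q)" "bilinear_map s w (\<lambda>p q. f (p * a) q)"
    "bilinear_map s w (\<lambda>p q. f p (a * q))" "bilinear_map s w (\<lambda>p q. f p (q * a))"
    "bilinear_map s w (\<lambda>p q. f (p * a) (q * b))"
  using assms by (simp_all add: bilinear_map_iff mult_scale_left mult_scale_right algebra_simps)

lemmas bilinear_tens_precomp = bilinear_precomp[OF bilinear_tens]

text \<open>The unit fixes the legs of one presentation only. That suffices, since a lift can be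
  computed on any presentation.\<close>

definition unit_for :: "'a \<Rightarrow> ('a, 'k) tensor2 \<Rightarrow> bool" where
  "unit_for z t \<longleftrightarrow> (\<exists>ps. t = sum_tens s ps \<and>
     (\<forall>(p, q)\<in>set ps. p * z = p \<and> z * p = p \<and> q * z = q \<and> z * q = q))"

text \<open>The legs of one chosen presentation of each tensor form a finite set, so a single local
  unit serves all the given tensors and elements at once.\<close>

lemma exists_unit:
  assumes "finite F" "finite Ts" "Ts \<subseteq> tensor_space s"
  shows "\<exists>z. (\<forall>x\<in>F. x * z = x \<and> z * x = x) \<and> (\<forall>t\<in>Ts. unit_for z t)"
proof -
  have "\<forall>t\<in>Ts. \<exists>ps. t = sum_tens s ps" using assms(3) in_tensor_space_iff by blast
  then obtain ps where ps: "\<forall>t\<in>Ts. t = sum_tens s (ps t)" by (rule bchoice[THEN exE])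
  let ?G = "F \<union> (\<Union>t\<in>Ts. fst ` set (ps t) \<union> snd ` set (ps t))"
  have "finite ?G" using assms by auto
  from local_unit[OF this] obtain z where z: "\<forall>x\<in>?G. x * z = x \<and> z * x = x" ..
  have "unit_for z t" if "t \<in> Ts" for t
    unfolding unit_for_def
  proof (intro exI conjI)
    show "t = sum_tens s (ps t)" using ps that by blast
    show "\<forall>(p, q)\<in>set (ps t). p * z = p \<and> z * p = p \<and> q * z = q \<and> z * q = q"
    proof clarify
      fix p q assume "(p, q) \<in> set (ps t)"
      then have "p \<in> fst ` set (ps t)" "q \<in> snd ` set (ps t)" by force+
      then have "p \<in> ?G" "q \<in> ?G" using that by blast+
      then show "p * z = p \<and> z * p = p \<and> q * z = q \<and> z * q = q" using z by blast
    qed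
  qed
  then show ?thesis using z by blast
qed

lemma lift_unit_for:
  assumes "vector_space w" "bilinear_map s w f" "unit_for z t"
  shows "tensor_lift s (\<lambda>p q. f (p * z) q) t = tensor_lift s f t"
    "tensor_lift s (\<lambda>p q. f (z * p) q) t = tensor_lift s f t"
    "tensor_lift s (\<lambda>p q. f p (q * z)) t = tensor_lift s f t"
    "tensor_lift s (\<lambda>p q. f p (z * q)) t = tensor_lift s f t"
proof -
  obtain ps where t: "t = sum_tens s ps"
    and z: "\<And>p q. (p, q) \<in> set ps \<Longrightarrow> p * z = p \<and> z * p = p \<and> q * z = q \<and> z * q = q"
    using assms(3) unfolding unit_for_def by blast
  have eq: "tensor_lift s g t = tensor_lift s f t"
    if "bilinear_map s w g" "\<And>p q. (p, q) \<in> set ps \<Longrightarrow> g p q = f p q" for g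
    unfolding t lift_sum_tens[OF assms(1) that(1)] lift_sum_tens[OF assms(1,2)]
    using that(2) by (intro arg_cong[of _ _ sum_list] map_cong) auto
  show "tensor_lift s (\<lambda>p q. f (p * z) q) t = tensor_lift s f t"
    "tensor_lift s (\<lambda>p q. f (z * p) q) t = tensor_lift s f t"
    "tensor_lift s (\<lambda>p q. f p (q * z)) t = tensor_lift s f t"
    "tensor_lift s (\<lambda>p q. f p (z * q)) t = tensor_lift s f t"
    by (rule eq; simp add: bilinear_precomp[OF assms(2)] z)+
qed

section \<open>The embedding of the tensor square into its multipliers\<close>

lemma tensor_mult_tens_right:
  "tensor_mult s t (tens s a b) = tensor_lift s (\<lambda>p q. tens s (p * a) (q * b)) t"
proof -
  have "bilinear_map s (fscale (*)) (\<lambda>c d. tens s (p * c) (q * d))" for p q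
    by (simp add: bilinear_map_iff tens_simps)
  then show ?thesis
    unfolding tensor_mult_def by (simp add: lift_tens[OF vector_space_tensor])
qed

text \<open>Evaluating the multiplier at \<open>tens s z z\<close>, for a common unit
  \<open>z\<close> of both tensors, gives each of them back. Injectivity is what makes
  \<open>tensor_elem\<close> a genuine inverse.\<close>

lemma inj_tensor_emb: "inj_on (tensor_emb s) (tensor_space s)"
proof (rule inj_onI)
  fix t u assume t: "t \<in> tensor_space s" and u: "u \<in> tensor_space s"
    and eq: "tensor_emb s t = tensor_emb s u"
  obtain z where z: "unit_for z t" "unit_for z u"
    using exists_unit[of "{}" "{t, u}"] t u by auto
  have *: "fst (tensor_emb s v) (tens s z z) = v" if "v \<in> tensor_space s" "unit_for z v" for v
  proof -
    have "fst (tensor_emb s v) (tens s z z) = tensor_lift s (\<lambda>p q. tens s (p * z) (q * z)) v"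
      by (simp add: tensor_emb_def mult_emb_def tensor_mult_tens_right)
    also have "\<dots> = v"
      using lift_unit_for(1)[OF vector_space_tensor bilinear_tens_precomp(4) that(2)]
        lift_unit_for(3)[OF vector_space_tensor bilinear_tens that(2)] lift_tens_id[OF that(1)]
      by simp
    finally show ?thesis .
  qed
  show "t = u" using *[OF t z(1)] *[OF u z(2)] unfolding eq by (rule trans[OF sym])
qed

lemma tensor_elem_spec:
  assumes "m \<in> tensor_emb s ` tensor_space s"
  shows "tensor_elem s m \<in> tensor_space s" "tensor_emb s (tensor_elem s m) = m"
  unfolding tensor_elem_def
  using the_inv_into_into[OF inj_tensor_emb assms] f_the_inv_into_f[OF inj_tensor_emb assms]
  by auto

lemma tensor_elem_emb: "t \<in> tensor_space s \<Longrightarrow> tensor_elem s (tensor_emb s t) = t"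
  unfolding tensor_elem_def by (rule the_inv_into_f_f[OF inj_tensor_emb])

lemma leg_tens:
  "fst (leg1 s a) (tens s p q) = tens s (a * p) q"
  "fst (leg2 s a) (tens s p q) = tens s p (a * q)"
  by (simp_all add: leg1_def leg2_def lift_tens[OF vector_space_tensor] bilinear_tens_precomp)

lemma fst_emb_tens:
  "fst (tensor_emb s t) (tens s a b) = tensor_lift s (\<lambda>p q. tens s (p * a) (q * b)) t"
  by (simp add: tensor_emb_def mult_emb_def tensor_mult_tens_right)

subsection \<open>The flip\<close>

lemma bilinear_flip: "bilinear_map s (fscale (*)) (\<lambda>a b. tens s b a)"
  by (simp add: bilinear_map_iff tens_simps)

lemma flip_tens: "flip s (tens s a b) = tens s b a"
  by (simp add: flip_def lift_tens[OF vector_space_tensor bilinear_flip])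

lemma flip_add: "t \<in> tensor_space s \<Longrightarrow> u \<in> tensor_space s \<Longrightarrow> flip s (t + u) = flip s t + flip s u"
  by (simp add: flip_def lift_add[OF vector_space_tensor bilinear_flip])

lemma flip_zero: "flip s 0 = 0"
  by (simp add: flip_def lift_zero[OF vector_space_tensor bilinear_flip])

lemma flip_in_space: "flip s t \<in> tensor_space s"
proof (cases "t \<in> tensor_space s")
  case True
  then show ?thesis
    by (induction rule: tensor_space_induct) (simp_all add: flip_zero flip_tens flip_add)
qed (simp add: flip_def tensor_lift_def)

lemma flip_flip: "t \<in> tensor_space s \<Longrightarrow> flip s (flip s t) = t"
  by (induction rule: tensor_space_induct)
    (simp_all add: flip_zero flip_tens flip_add flip_in_space)

lemma flip_lift:
  assumes "bilinear_map s (fscale (*)) f" "\<And>a b. f a b \<in> tensor_space s" "t \<in> tensor_space s"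
  shows "flip s (tensor_lift s f t) = tensor_lift s (\<lambda>a b. flip s (f a b)) t"
  unfolding flip_def
  by (rule lift_comp_lift[OF vector_space_tensor bilinear_flip assms(3,1,2)])

lemma lift_flip:
  assumes "vector_space w" "bilinear_map s w f" "t \<in> tensor_space s"
  shows "tensor_lift s f (flip s t) = tensor_lift s (\<lambda>a b. f b a) t"
  unfolding flip_def by (rule lift_lift_tens[OF assms bilinear_flip])

text \<open>The outer map in \<open>tensor_mult\<close> must be bilinear before any rule for lifts
  applies to it.\<close>

lemma bilinear_lift_tens_mult:
  assumes "u \<in> tensor_space s"
  shows "bilinear_map s (fscale (*)) (\<lambda>a b. tensor_lift s (\<lambda>c d. tens s (a * c) (b * d)) u)"
proof -
  have b: "bilinear_map s (fscale (*)) (\<lambda>c d. tens s (a * c) (b * d))" for a b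
    by (simp add: bilinear_map_iff tens_simps)
  show ?thesis
    using assms
    by (simp add: bilinear_map_iff tens_simps lift_add_fun[OF vector_space_tensor b b]
        lift_scale_fun[OF vector_space_tensor b])
qed

lemma flip_tensor_mult:
  assumes t: "t \<in> tensor_space s" and u: "u \<in> tensor_space s"
  shows "flip s (tensor_mult s t u) = tensor_mult s (flip s t) (flip s u)"
proof -
  have b: "bilinear_map s (fscale (*)) (\<lambda>c d. tens s (a * c) (b * d))" for a b
    by (simp add: bilinear_map_iff tens_simps)
  have in_space: "tensor_lift s (\<lambda>c d. tens s (a * c) (b * d)) u \<in> tensor_space s" for a b
    by (rule lift_in_subspace[OF vector_space_tensor b u subspace_tensor_space]) simp
  have "flip s (tensor_mult s t u) =
      tensor_lift s (\<lambda>a b. flip s (tensor_lift s (\<lambda>c d. tens s (a * c) (b * d)) u)) t"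
    unfolding tensor_mult_def
    by (rule flip_lift[OF bilinear_lift_tens_mult[OF u] in_space t])
  also have "\<dots> = tensor_lift s (\<lambda>a b. tensor_lift s (\<lambda>c d. tens s (b * d) (a * c)) u) t"
    by (simp add: flip_lift[OF b _ u] flip_tens)
  also have "\<dots> = tensor_lift s (\<lambda>a b. tensor_lift s (\<lambda>c d. tens s (b * c) (a * d)) (flip s u)) t"
    by (simp add: lift_flip[OF vector_space_tensor b u])
  also have "\<dots> = tensor_mult s (flip s t) (flip s u)"
    unfolding tensor_mult_def
    by (simp add: lift_flip[OF vector_space_tensor bilinear_lift_tens_mult[OF flip_in_space] t])
  finally show ?thesis .
qed

text \<open>Conjugation by the flip exchanges the two legs; this carries statements about the
  flipped comultiplication back to \<open>\<Delta>\<close>.\<close>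

lemma flip_leg2:
  assumes "t \<in> tensor_space s"
  shows "flip s (fst (leg2 s a) (flip s t)) = fst (leg1 s a) t"
    "snd (leg2 s a) (flip s t) = flip s (snd (leg1 s a) t)"
proof -
  note b = bilinear_tens_precomp[of a]
  show "flip s (fst (leg2 s a) (flip s t)) = fst (leg1 s a) t"
    unfolding leg1_def leg2_def
    by (simp add: flip_lift[OF b(3) _ flip_in_space] flip_tens)
      (simp add: lift_flip[OF vector_space_tensor _ assms] bilinear_map_iff tens_simps)
  show "snd (leg2 s a) (flip s t) = flip s (snd (leg1 s a) t)"
    unfolding leg1_def leg2_def
    by (simp add: flip_lift[OF b(2) _ assms] flip_tens lift_flip[OF vector_space_tensor b(4) assms])
qed

end

section \<open>Regular multiplier Hopf algebras\<close>

locale regular_hopf = local_unit_algebra s for s :: "'k::field \<Rightarrow> 'a::ring \<Rightarrow> 'a" +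
  fixes \<Delta> :: "('a, 'k) comult"
  assumes regular: "regular_multiplier_hopf_algebra s \<Delta>"
begin

abbreviation "r1 \<equiv> cov_r1 s \<Delta>"
abbreviation "r2 \<equiv> cov_r2 s \<Delta>"
abbreviation "l1 \<equiv> cov_l1 s \<Delta>"

lemma hopf: "multiplier_hopf_algebra s \<Delta>" "multiplier_hopf_algebra s (\<lambda>a. flip_mult s (\<Delta> a))"
  using regular by (auto simp: regular_multiplier_hopf_algebra_def)

section \<open>The comultiplication as a family of multipliers\<close>

lemma Delta_multiplier: "\<Delta> a \<in> multipliers (fscale (*)) (tensor_space s) (tensor_mult s)"
  using hopf(1) by (auto simp: multiplier_hopf_algebra_def comult_hom_def)

lemma fst_Delta_linear: "linear_on (fscale (*)) (fscale (*)) (tensor_space s) (tensor_space s) (fst (\<Delta> a))"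
  and Delta_outside: "t \<notin> tensor_space s \<Longrightarrow> fst (\<Delta> a) t = 0" "t \<notin> tensor_space s \<Longrightarrow> snd (\<Delta> a) t = 0"
  and snd_Delta_in_space: "t \<in> tensor_space s \<Longrightarrow> snd (\<Delta> a) t \<in> tensor_space s"
  using Delta_multiplier[of a] by (auto simp: multipliers_def linear_on_def split: prod.splits)

lemma Delta_in_space: "t \<in> tensor_space s \<Longrightarrow> fst (\<Delta> a) t \<in> tensor_space s"
  and Delta_add: "t \<in> tensor_space s \<Longrightarrow> u \<in> tensor_space s \<Longrightarrow>
    fst (\<Delta> a) (t + u) = fst (\<Delta> a) t + fst (\<Delta> a) u"
  and Delta_scale: "t \<in> tensor_space s \<Longrightarrow> fst (\<Delta> a) (fscale (*) k t) = fscale (*) k (fst (\<Delta> a) t)"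
  using fst_Delta_linear[of a] by (auto simp: linear_on_def)

lemma Delta_zero: "fst (\<Delta> a) 0 = 0"
proof -
  have "fst (\<Delta> a) (0 + 0) = fst (\<Delta> a) 0 + fst (\<Delta> a) 0"
    by (rule Delta_add) simp_all
  then show ?thesis by simp
qed

lemma Delta_add_arg: "fst (\<Delta> (a + b)) t = fst (\<Delta> a) t + fst (\<Delta> b) t"
  and Delta_scale_arg: "fst (\<Delta> (s k a)) t = fscale (*) k (fst (\<Delta> a) t)"
proof -
  interpret D: Vector_Spaces.linear s "fscale (fscale (*))" "\<lambda>a. fst (\<Delta> a)"
    using hopf(1) by (auto simp: multiplier_hopf_algebra_def comult_hom_def)
  show "fst (\<Delta> (a + b)) t = fst (\<Delta> a) t + fst (\<Delta> b) t"
    by (simp add: D.add plus_fun_apply)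
  show "fst (\<Delta> (s k a)) t = fscale (*) k (fst (\<Delta> a) t)"
    by (simp add: D.scale) (simp add: fscale_def)
qed

lemma Delta_mult: "fst (\<Delta> (a * b)) t = fst (\<Delta> a) (fst (\<Delta> b) t)"
proof -
  have "\<Delta> (a * b) = mult_comp (\<Delta> a) (\<Delta> b)"
    using hopf(1) by (auto simp: multiplier_hopf_algebra_def comult_hom_def)
  then show ?thesis by (simp add: mult_comp_def)
qed

section \<open>Covered products of the comultiplication\<close>

lemma r2_in_space [simp]: "r2 a b \<in> tensor_space s"
  and emb_r2: "tensor_emb s (r2 a b) = mult_comp (\<Delta> a) (leg2 s b)"
proof -
  have "mult_comp (\<Delta> a) (leg2 s b) \<in> tensor_emb s ` tensor_space s"
    using hopf(1) by (auto simp: multiplier_hopf_algebra_def)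
  from tensor_elem_spec[OF this]
  show "r2 a b \<in> tensor_space s" "tensor_emb s (r2 a b) = mult_comp (\<Delta> a) (leg2 s b)"
    by (auto simp: cov_r2_def)
qed

lemma l1_in_space [simp]: "l1 a b \<in> tensor_space s"
  and emb_l1: "tensor_emb s (l1 a b) = mult_comp (leg1 s a) (\<Delta> b)"
proof -
  have "mult_comp (leg1 s a) (\<Delta> b) \<in> tensor_emb s ` tensor_space s"
    using hopf(1) by (auto simp: multiplier_hopf_algebra_def)
  from tensor_elem_spec[OF this]
  show "l1 a b \<in> tensor_space s" "tensor_emb s (l1 a b) = mult_comp (leg1 s a) (\<Delta> b)"
    by (auto simp: cov_l1_def)
qed

text \<open>The covered product of the flipped comultiplication with \<open>leg2 s b\<close>,
  conjugated by the flip, is the product of \<open>\<Delta>\<close> with \<open>leg1 s b\<close>;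
  the flip is multiplicative and exchanges the legs.\<close>

lemma emb_flip:
  assumes t: "t \<in> tensor_space s"
    and eq: "mult_comp (flip_mult s (\<Delta> a)) (leg2 s b) = tensor_emb s t"
  shows "mult_comp (\<Delta> a) (leg1 s b) = tensor_emb s (flip s t)"
proof -
  \<comment> \<open>Multipliers are pairs of total functions, so equality has to be checked outside
    the tensor space as well, where every map takes the default value 0.\<close>
  have leg0: "fst (leg1 s b) v = 0" if "v \<notin> tensor_space s" for v
    using that by (simp add: leg1_def tensor_lift_def)
  have leg_zero: "snd (leg1 s b) 0 = 0"
    by (simp add: leg1_def lift_zero[OF vector_space_tensor bilinear_tens_precomp(2)])
  have leg_in: "fst (leg1 s b) v \<in> tensor_space s" "snd (leg1 s b) v \<in> tensor_space s"
    if "v \<in> tensor_space s" for v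
    by (simp_all add: leg1_def lift_in_subspace[OF vector_space_tensor _ that subspace_tensor_space]
        bilinear_tens_precomp)
  have 1: "fst (\<Delta> a) (fst (leg1 s b) v) = tensor_mult s (flip s t) v" if v: "v \<in> tensor_space s" for v
  proof -
    have "flip s (fst (\<Delta> a) (flip s (fst (leg2 s b) (flip s v)))) = tensor_mult s t (flip s v)"
      using arg_cong[OF eq, of "\<lambda>m. fst m (flip s v)"]
      by (simp add: mult_comp_def flip_mult_def tensor_emb_def mult_emb_def flip_in_space)
    then have "flip s (fst (\<Delta> a) (fst (leg1 s b) v)) = tensor_mult s t (flip s v)"
      by (simp add: flip_leg2[OF v])
    from arg_cong[OF this, of "flip s"] show ?thesis
      by (simp add: flip_flip Delta_in_space leg_in v flip_tensor_mult[OF t flip_in_space])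
  qed
  have 2: "snd (leg1 s b) (snd (\<Delta> a) v) = tensor_mult s v (flip s t)" if v: "v \<in> tensor_space s" for v
  proof -
    have "snd (leg2 s b) (flip s (snd (\<Delta> a) (flip s (flip s v)))) = tensor_mult s (flip s v) t"
      using arg_cong[OF eq, of "\<lambda>m. snd m (flip s v)"]
      by (simp add: mult_comp_def flip_mult_def tensor_emb_def mult_emb_def flip_in_space)
    then have "flip s (snd (leg1 s b) (snd (\<Delta> a) v)) = tensor_mult s (flip s v) t"
      by (simp add: flip_leg2 snd_Delta_in_space v flip_flip)
    from arg_cong[OF this, of "flip s"] show ?thesis
      by (simp add: flip_flip snd_Delta_in_space leg_in v flip_tensor_mult[OF flip_in_space t])
  qed
  show ?thesis
    by (auto simp: mult_comp_def tensor_emb_def mult_emb_def fun_eq_iff 1 2 leg0 Delta_zero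
        Delta_outside leg_zero)
qed

text \<open>This is where regularity supplies the covering of the first leg from the right. The
  third claim relates the canonical map of the flipped structure to \<open>r1\<close>, which later
  gives \<open>r1_surj\<close>.\<close>

lemma r1_in_space [simp]: "r1 a b \<in> tensor_space s"
  and emb_r1: "tensor_emb s (r1 a b) = mult_comp (\<Delta> a) (leg1 s b)"
  and r2_flip_mult: "cov_r2 s (\<lambda>a. flip_mult s (\<Delta> a)) a b = flip s (r1 a b)"
proof -
  have "mult_comp (flip_mult s (\<Delta> a)) (leg2 s b) \<in> tensor_emb s ` tensor_space s"
    using hopf(2) by (auto simp: multiplier_hopf_algebra_def)
  then obtain t where t: "t \<in> tensor_space s"
    and eq: "mult_comp (flip_mult s (\<Delta> a)) (leg2 s b) = tensor_emb s t"
    by blast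
  have r1: "r1 a b = flip s t"
    unfolding cov_r1_def emb_flip[OF t eq] by (rule tensor_elem_emb[OF flip_in_space])
  then show "r1 a b \<in> tensor_space s" by (simp add: flip_in_space)
  show "tensor_emb s (r1 a b) = mult_comp (\<Delta> a) (leg1 s b)"
    by (simp only: r1 emb_flip[OF t eq])
  show "cov_r2 s (\<lambda>a. flip_mult s (\<Delta> a)) a b = flip s (r1 a b)"
    by (simp add: cov_r2_def eq tensor_elem_emb[OF t] r1 flip_flip[OF t])
qed

text \<open>Writing \<open>b = b * z\<close> factors \<open>tens s a b\<close> as
  \<open>leg2 s b\<close> applied to \<open>tens s a z\<close>, so \<open>\<Delta> c\<close> meets
  \<open>leg2 s b\<close> first and forms \<open>r2 c b\<close>. Since \<open>z\<close> is also a
  unit for \<open>r2 c b\<close>, it then disappears.\<close>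

lemma Delta_tens_r2: "fst (\<Delta> c) (tens s a b) = tensor_lift s (\<lambda>p q. tens s (p * a) q) (r2 c b)"
proof -
  obtain z where z: "b * z = b" "unit_for z (r2 c b)"
    using exists_unit[of "{b}" "{r2 c b}"] by auto
  have "fst (\<Delta> c) (tens s a b) = fst (tensor_emb s (r2 c b)) (tens s a z)"
    by (simp add: emb_r2 mult_comp_def leg_tens z(1))
  also have "\<dots> = tensor_lift s (\<lambda>p q. tens s (p * a) q) (r2 c b)"
    unfolding fst_emb_tens
    by (rule lift_unit_for(3)[OF vector_space_tensor bilinear_tens_precomp(2) z(2)])
  finally show ?thesis .
qed

lemma Delta_tens_r1: "fst (\<Delta> c) (tens s a b) = tensor_lift s (\<lambda>p q. tens s p (q * b)) (r1 c a)"
proof -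
  obtain z where z: "a * z = a" "unit_for z (r1 c a)"
    using exists_unit[of "{a}" "{r1 c a}"] by auto
  have "fst (\<Delta> c) (tens s a b) = fst (tensor_emb s (r1 c a)) (tens s z b)"
    by (simp add: emb_r1 mult_comp_def leg_tens z(1))
  also have "\<dots> = tensor_lift s (\<lambda>p q. tens s p (q * b)) (r1 c a)"
    unfolding fst_emb_tens
    by (rule lift_unit_for(1)[OF vector_space_tensor bilinear_tens_precomp(4) z(2)])
  finally show ?thesis .
qed

text \<open>The covered product is defined by inverting an embedding. Filling the free leg with a
  unit expresses it through \<open>\<Delta>\<close>, from which linearity and multiplicativity are
  inherited once one unit is chosen for all tensors involved.\<close>

lemma r2_eq_Delta: "unit_for z (r2 c b) \<Longrightarrow> r2 c b = fst (\<Delta> c) (tens s z b)"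
  unfolding Delta_tens_r2
  by (simp add: lift_unit_for(1)[OF vector_space_tensor bilinear_tens] lift_tens_id)

lemma r1_eq_Delta: "unit_for z (r1 c a) \<Longrightarrow> r1 c a = fst (\<Delta> c) (tens s a z)"
  unfolding Delta_tens_r1
  by (simp add: lift_unit_for(3)[OF vector_space_tensor bilinear_tens] lift_tens_id)

lemma bilinear_r2: "bilinear_map s (fscale (*)) r2"
proof -
  have "r2 (a + b) c = r2 a c + r2 b c" for a b c
  proof -
    obtain z where z: "unit_for z (r2 (a + b) c)" "unit_for z (r2 a c)" "unit_for z (r2 b c)"
      using exists_unit[of "{}" "{r2 (a + b) c, r2 a c, r2 b c}"] by auto
    then show ?thesis by (simp only: z[THEN r2_eq_Delta] Delta_add_arg)
  qed
  moreover have "r2 a (b + c) = r2 a b + r2 a c" for a b c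
  proof -
    obtain z where z: "unit_for z (r2 a (b + c))" "unit_for z (r2 a b)" "unit_for z (r2 a c)"
      using exists_unit[of "{}" "{r2 a (b + c), r2 a b, r2 a c}"] by auto
    then show ?thesis by (simp only: z[THEN r2_eq_Delta] tens_add_right Delta_add tens_in_space)
  qed
  moreover have "r2 (s k a) b = fscale (*) k (r2 a b)" for k a b
  proof -
    obtain z where z: "unit_for z (r2 (s k a) b)" "unit_for z (r2 a b)"
      using exists_unit[of "{}" "{r2 (s k a) b, r2 a b}"] by auto
    then show ?thesis by (simp only: z[THEN r2_eq_Delta] Delta_scale_arg)
  qed
  moreover have "r2 a (s k b) = fscale (*) k (r2 a b)" for k a b
  proof -
    obtain z where z: "unit_for z (r2 a (s k b))" "unit_for z (r2 a b)"
      using exists_unit[of "{}" "{r2 a (s k b), r2 a b}"] by auto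
    then show ?thesis by (simp only: z[THEN r2_eq_Delta] tens_scale_right Delta_scale tens_in_space)
  qed
  ultimately show ?thesis by (simp add: bilinear_map_iff)
qed

lemma bilinear_r1: "bilinear_map s (fscale (*)) r1"
proof -
  have "r1 (a + b) c = r1 a c + r1 b c" for a b c
  proof -
    obtain z where z: "unit_for z (r1 (a + b) c)" "unit_for z (r1 a c)" "unit_for z (r1 b c)"
      using exists_unit[of "{}" "{r1 (a + b) c, r1 a c, r1 b c}"] by auto
    then show ?thesis by (simp only: z[THEN r1_eq_Delta] Delta_add_arg)
  qed
  moreover have "r1 a (b + c) = r1 a b + r1 a c" for a b c
  proof -
    obtain z where z: "unit_for z (r1 a (b + c))" "unit_for z (r1 a b)" "unit_for z (r1 a c)"
      using exists_unit[of "{}" "{r1 a (b + c), r1 a b, r1 a c}"] by auto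
    then show ?thesis by (simp only: z[THEN r1_eq_Delta] tens_add_left Delta_add tens_in_space)
  qed
  moreover have "r1 (s k a) b = fscale (*) k (r1 a b)" for k a b
  proof -
    obtain z where z: "unit_for z (r1 (s k a) b)" "unit_for z (r1 a b)"
      using exists_unit[of "{}" "{r1 (s k a) b, r1 a b}"] by auto
    then show ?thesis by (simp only: z[THEN r1_eq_Delta] Delta_scale_arg)
  qed
  moreover have "r1 a (s k b) = fscale (*) k (r1 a b)" for k a b
  proof -
    obtain z where z: "unit_for z (r1 a (s k b))" "unit_for z (r1 a b)"
      using exists_unit[of "{}" "{r1 a (s k b), r1 a b}"] by auto
    then show ?thesis by (simp only: z[THEN r1_eq_Delta] tens_scale_left Delta_scale tens_in_space)
  qed
  ultimately show ?thesis by (simp add: bilinear_map_iff)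
qed

lemma Delta_r2: "fst (\<Delta> c) (r2 a b) = r2 (c * a) b"
proof -
  obtain z where z: "unit_for z (r2 (c * a) b)" "unit_for z (r2 a b)"
    using exists_unit[of "{}" "{r2 (c * a) b, r2 a b}"] by auto
  then show ?thesis by (simp only: z[THEN r2_eq_Delta] Delta_mult)
qed

text \<open>The surjective half of the bijectivity axiom, in list form to allow induction over the
  summands.\<close>

lemma r2_surj:
  assumes "t \<in> tensor_space s"
  obtains ps where "t = (\<Sum>(a, b)\<leftarrow>ps. r2 a b)"
proof -
  have "bij_betw (tensor_lift s r2) (tensor_space s) (tensor_space s)"
    using hopf(1) by (auto simp: multiplier_hopf_algebra_def)
  then obtain u where "u \<in> tensor_space s" "t = tensor_lift s r2 u"
    using assms by (auto simp: bij_betw_def)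
  moreover from this(1) obtain ps where "u = sum_tens s ps" by (rule tensor_space_cases)
  ultimately show thesis
    using that lift_sum_tens[OF vector_space_tensor bilinear_r2] by metis
qed

text \<open>By \<open>r2_flip_mult\<close> the canonical map of the flipped structure is
  \<open>r1\<close> followed by the flip. It is onto, and undoing the flip gives the claim for
  \<open>r1\<close>.\<close>

lemma r1_surj:
  assumes "t \<in> tensor_space s"
  obtains ps where "t = (\<Sum>(a, b)\<leftarrow>ps. r1 a b)"
proof -
  have "bij_betw (tensor_lift s (\<lambda>a b. flip s (r1 a b))) (tensor_space s) (tensor_space s)"
    using hopf(2) by (auto simp: multiplier_hopf_algebra_def r2_flip_mult)
  then obtain u where u: "u \<in> tensor_space s" "flip s t = tensor_lift s (\<lambda>a b. flip s (r1 a b)) u"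
    using flip_in_space[of t] by (auto simp: bij_betw_def)
  have r1u: "tensor_lift s r1 u \<in> tensor_space s"
    by (rule lift_in_subspace[OF vector_space_tensor bilinear_r1 u(1) subspace_tensor_space]) simp
  have "flip s t = flip s (tensor_lift s r1 u)"
    by (simp add: u(2) flip_lift[OF bilinear_r1 _ u(1)])
  then have "t = tensor_lift s r1 u"
    using flip_flip assms r1u by metis
  moreover from u(1) obtain ps where "u = sum_tens s ps" by (rule tensor_space_cases)
  ultimately show thesis
    using that lift_sum_tens[OF vector_space_tensor bilinear_r1] by metis
qed

text \<open>Both sides are the product of \<open>\<Delta> p\<close> with \<open>a\<close> on the
  left and \<open>d\<close> on the right of the first leg, bracketed in the two possible
  ways.\<close>

lemma l1_r1:
  "tensor_lift s (\<lambda>u v. tens s (u * d) v) (l1 a p) = tensor_lift s (\<lambda>u v. tens s (a * u) v) (r1 p d)"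
proof -
  obtain z where z: "unit_for z (l1 a p)" "unit_for z (r1 p d)"
    using exists_unit[of "{}" "{l1 a p, r1 p d}"] by auto
  \<comment> \<open>The second leg is filled with \<open>z\<close>, which acts trivially on
    \<open>l1 a p\<close> here and on \<open>r1 p d\<close> in the next step.\<close>
  have "tensor_lift s (\<lambda>u v. tens s (u * d) v) (l1 a p) = fst (tensor_emb s (l1 a p)) (tens s d z)"
    unfolding fst_emb_tens
    by (rule lift_unit_for(3)[OF vector_space_tensor bilinear_tens_precomp(2) z(1), symmetric])
  also have "\<dots> = fst (leg1 s a) (r1 p d)"
    by (simp add: emb_l1 mult_comp_def r1_eq_Delta[OF z(2)])
  finally show ?thesis by (simp add: leg1_def)
qed

lemma lift_l1_r1:
  assumes w: "vector_space w" and f: "bilinear_map s w f"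
  shows "tensor_lift s (\<lambda>u v. f (u * d) v) (l1 a p) = tensor_lift s (\<lambda>u v. f (a * u) v) (r1 p d)"
  using lift_lift_tens[OF w f l1_in_space bilinear_tens_precomp(2), of d a p]
    lift_lift_tens[OF w f r1_in_space bilinear_tens_precomp(1), of a p d] l1_r1[of d a p]
  by simp

lemma l1_eq_r1: "unit_for z (l1 a p) \<Longrightarrow> l1 a p = tensor_lift s (\<lambda>u v. tens s (a * u) v) (r1 p z)"
  unfolding l1_r1[symmetric]
  by (simp add: lift_unit_for(1)[OF vector_space_tensor bilinear_tens] lift_tens_id)

lemma linear_l1: "linear_on s (fscale (*)) UNIV (tensor_space s) (l1 a)"
proof -
  note b = bilinear_tens_precomp(1)[of a]
  have "l1 a (p + q) = l1 a p + l1 a q" for p q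
  proof -
    obtain z where z: "unit_for z (l1 a (p + q))" "unit_for z (l1 a p)" "unit_for z (l1 a q)"
      using exists_unit[of "{}" "{l1 a (p + q), l1 a p, l1 a q}"] by auto
    moreover have "r1 (p + q) z = r1 p z + r1 q z" for z
      using bilinear_r1 by (simp add: bilinear_map_iff)
    ultimately show ?thesis
      by (simp only: z[THEN l1_eq_r1] lift_add[OF vector_space_tensor b r1_in_space r1_in_space])
  qed
  moreover have "l1 a (s k p) = fscale (*) k (l1 a p)" for k p
  proof -
    obtain z where z: "unit_for z (l1 a (s k p))" "unit_for z (l1 a p)"
      using exists_unit[of "{}" "{l1 a (s k p), l1 a p}"] by auto
    moreover have "r1 (s k p) z = fscale (*) k (r1 p z)" for z
      using bilinear_r1 by (simp add: bilinear_map_iff)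
    ultimately show ?thesis
      by (simp only: z[THEN l1_eq_r1] lift_scale[OF vector_space_tensor b r1_in_space])
  qed
  ultimately show ?thesis by (simp add: linear_on_def)
qed

section \<open>Coassociativity with values in an arbitrary vector space\<close>

lemma linear_r1: "linear_on s (fscale (*)) UNIV (tensor_space s) (\<lambda>p. r1 p d)"
  and linear_r2: "linear_on s (fscale (*)) UNIV (tensor_space s) (\<lambda>p. r2 p d)"
  using bilinear_r1 bilinear_r2 by (auto simp: linear_on_def bilinear_map_iff)

text \<open>Threefold tensors are functionals on trilinear forms. Evaluation at
  \<open>\<tau>\<close> is linear and hence commutes with both lifts on each side of the
  axiom.\<close>

lemma coassoc_form:
  assumes \<tau>: "trilinear_map s (*) \<tau>"
  shows "tensor_lift s (\<lambda>p q. tensor_lift s (\<lambda>u v. \<tau> u v q) (l1 a p)) (r2 b c) =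
    tensor_lift s (\<lambda>p q. tensor_lift s (\<tau> p) (r2 q c)) (l1 a b)"
proof -
  have vs: "vector_space (fscale (*) :: 'k \<Rightarrow> ('a, 'k) tensor3 \<Rightarrow> ('a, 'k) tensor3)"
    by (rule vector_space_fscale[OF vector_space_field])
  have ev: "Vector_Spaces.linear (fscale (*)) (*) (\<lambda>T :: ('a, 'k) tensor3. T \<tau>)"
    by (rule linear_evaluation[OF vector_space_field])
  have b1: "bilinear_map s (fscale (*)) (\<lambda>u v. tens3 s u v q)" for q
    using trilinear_tens3 by (simp add: trilinear_map_def bilinear_map_iff linear_on_def)
  have b2: "bilinear_map s (fscale (*)) (tens3 s p)" for p
    using trilinear_tens3 by (simp add: trilinear_map_def)
  have "tensor_lift s (\<lambda>p q. tensor_lift s (\<lambda>u v. tens3 s u v q) (l1 a p)) (r2 b c) \<tau> =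
      tensor_lift s (\<lambda>p q. tensor_lift s (tens3 s p) (r2 q c)) (l1 a b) \<tau>"
    using hopf(1) by (simp add: multiplier_hopf_algebra_def coassociative_def)
  then show ?thesis
    using lift_comp_linear[OF bilinear_lift_left[OF vs trilinear_tens3 linear_l1] ev r2_in_space]
      lift_comp_linear[OF bilinear_lift_right[OF vs trilinear_tens3 linear_r2] ev l1_in_space]
      lift_comp_linear[OF b1 ev l1_in_space] lift_comp_linear[OF b2 ev r2_in_space]
    by (simp add: tens3_eval[OF \<tau>])
qed

text \<open>Composing \<open>\<tau>\<close> with functionals on the target space reduces the claim
  to scalar forms.\<close>

lemma coassoc_l1:
  assumes w: "vector_space w" and \<tau>: "trilinear_map s w \<tau>"
  shows "tensor_lift s (\<lambda>p q. tensor_lift s (\<lambda>u v. \<tau> u v q) (l1 a p)) (r2 b c) =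
    tensor_lift s (\<lambda>p q. tensor_lift s (\<tau> p) (r2 q c)) (l1 a b)"
proof (rule eq_if_functionals_eq[OF w])
  fix \<xi> :: "'b \<Rightarrow> 'k" assume \<xi>: "Vector_Spaces.linear w (*) \<xi>"
  then interpret l: Vector_Spaces.linear w "(*)" \<xi> .
  have "trilinear_map s (*) (\<lambda>x y z. \<xi> (\<tau> x y z))"
    using \<tau> by (simp add: trilinear_map_def bilinear_map_iff linear_on_def l.add l.scale)
  note eq = coassoc_form[OF this, of a b c]
  have b1: "bilinear_map s w (\<lambda>u v. \<tau> u v q)" for q
    using \<tau> by (simp add: trilinear_map_def bilinear_map_iff linear_on_def)
  have b2: "bilinear_map s w (\<tau> p)" for p
    using \<tau> by (simp add: trilinear_map_def)
  show "\<xi> (tensor_lift s (\<lambda>p q. tensor_lift s (\<lambda>u v. \<tau> u v q) (l1 a p)) (r2 b c)) =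
    \<xi> (tensor_lift s (\<lambda>p q. tensor_lift s (\<tau> p) (r2 q c)) (l1 a b))"
    using eq
      lift_comp_linear[OF bilinear_lift_left[OF w \<tau> linear_l1] \<xi> r2_in_space]
      lift_comp_linear[OF bilinear_lift_right[OF w \<tau> linear_r2] \<xi> l1_in_space]
      lift_comp_linear[OF b1 \<xi> l1_in_space] lift_comp_linear[OF b2 \<xi> r2_in_space]
    by simp
qed

text \<open>Coassociativity with the left factor \<open>a \<otimes> 1 \<otimes> 1\<close> traded for a right factor \<open>d \<otimes> 1 \<otimes> 1\<close>:
  multiplying by \<open>d \<otimes> 1 \<otimes> 1\<close> on the right is harmless, and \<open>a\<close> can then be chosen as a local unit.\<close>

lemma coassoc_r1:
  assumes w: "vector_space w" and \<tau>: "trilinear_map s w \<tau>"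
  shows "tensor_lift s (\<lambda>p q. tensor_lift s (\<lambda>u v. \<tau> u v q) (r1 p d)) (r2 b c) =
    tensor_lift s (\<lambda>p q. tensor_lift s (\<tau> p) (r2 q c)) (r1 b d)"
proof -
  obtain ps where ps: "r2 b c = sum_tens s ps" using r2_in_space by (rule tensor_space_cases)
  \<comment> \<open>The element \<open>a\<close> has to be a unit for \<open>r1 b d\<close> on one
    side and, on the other, for \<open>r1 p d\<close> with \<open>p\<close> any left leg of the
    chosen presentation of \<open>r2 b c\<close>.\<close>
  obtain a where a1: "unit_for a (r1 b d)" and "\<forall>x\<in>set ps. unit_for a (r1 (fst x) d)"
    using exists_unit[of "{}" "insert (r1 b d) ((\<lambda>x. r1 (fst x) d) ` set ps)"]
    by (auto simp: image_subset_iff)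
  then have a2: "unit_for a (r1 p d)" if "(p, q) \<in> set ps" for p q using that by force
  have b1: "bilinear_map s w (\<lambda>u v. \<tau> u v q)" for q
    using \<tau> by (simp add: trilinear_map_def bilinear_map_iff linear_on_def)
  have b2: "bilinear_map s w (\<lambda>p q. tensor_lift s (\<tau> p) (r2 q c))"
    by (rule bilinear_lift_right[OF w \<tau> linear_r2])
  have \<tau>d: "trilinear_map s w (\<lambda>u. \<tau> (u * d))"
    using \<tau> by (simp add: trilinear_map_def bilinear_map_iff linear_on_def distrib_right mult_scale_left)
  have "tensor_lift s (\<lambda>p q. tensor_lift s (\<lambda>u v. \<tau> u v q) (r1 p d)) (r2 b c) =
      (\<Sum>(p, q)\<leftarrow>ps. tensor_lift s (\<lambda>u v. \<tau> u v q) (r1 p d))"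
    by (simp only: ps lift_sum_tens[OF w bilinear_lift_left[OF w \<tau> linear_r1]])
  also have "\<dots> = (\<Sum>(p, q)\<leftarrow>ps. tensor_lift s (\<lambda>u v. \<tau> (u * d) v q) (l1 a p))"
    using lift_unit_for(2)[OF w b1 a2]
    by (intro arg_cong[of _ _ sum_list] map_cong refl)
      (auto simp: lift_l1_r1[OF w b1])
  also have "\<dots> = tensor_lift s (\<lambda>p q. tensor_lift s (\<lambda>u v. \<tau> (u * d) v q) (l1 a p)) (r2 b c)"
    by (simp only: ps lift_sum_tens[OF w bilinear_lift_left[OF w \<tau>d linear_l1]])
  also have "\<dots> = tensor_lift s (\<lambda>p q. tensor_lift s (\<tau> (p * d)) (r2 q c)) (l1 a b)"
    by (rule coassoc_l1[OF w \<tau>d])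
  also have "\<dots> = tensor_lift s (\<lambda>p q. tensor_lift s (\<tau> p) (r2 q c)) (r1 b d)"
    by (simp add: lift_l1_r1[OF w b2] lift_unit_for(2)[OF w b2 a1])
  finally show ?thesis .
qed

end

section \<open>The convolution product\<close>

locale hopf_convolution = regular_hopf s \<Delta>
  for s :: "'k::field \<Rightarrow> 'a::ring \<Rightarrow> 'a" and \<Delta> :: "('a, 'k) comult" +
  fixes sL :: "'k \<Rightarrow> 'l::ring \<Rightarrow> 'l"
  assumes vs_L: "vector_space sL"
    and L_scale_left: "sL c x * y = sL c (x * y)"
    and L_scale_right: "x * sL c y = sL c (x * y)"
begin

abbreviation lin :: "('a \<Rightarrow> 'l) \<Rightarrow> bool" where
  "lin \<equiv> Vector_Spaces.linear s sL"

abbreviation conv :: "('a \<Rightarrow> 'l) \<Rightarrow> ('a \<Rightarrow> 'l) \<Rightarrow> 'a \<Rightarrow> 'l" where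
  "conv \<equiv> hom_r_mult s \<Delta> sL"

lemma lin_iff: "lin f \<longleftrightarrow> (\<forall>x y. f (x + y) = f x + f y) \<and> (\<forall>c x. f (s c x) = sL c (f x))"
  by (rule linear_iff[OF vector_space_axioms vs_L])

text \<open>The space \<open>hom_r\<close> described without spans: by local units, a linear map is
  of the form \<open>rshift f a\<close> exactly when some \<open>e\<close> reproduces it.\<close>

definition hom_unital :: "('a \<Rightarrow> 'l) set" where
  "hom_unital = {h. lin h \<and> (\<exists>e. rshift h e = h)}"

section \<open>Linear maps reproduced by a local unit\<close>

lemma lin_rshift: "lin f \<Longrightarrow> lin (rshift f a)"
  by (simp add: lin_iff rshift_def distrib_right mult_scale_left)

lemma rshift_rshift: "rshift (rshift f a) b = rshift f (b * a)" for a :: 'a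
  by (simp add: rshift_def mult.assoc)

lemma rshift_add: "rshift (f + g) a = rshift f a + rshift g a"
  by (simp add: rshift_def fun_eq_iff plus_fun_apply)

lemma rshift_scale: "rshift (fscale sL c f) a = fscale sL c (rshift f a)"
  by (simp add: rshift_def fscale_def)

lemma rshift_in_hom_unital:
  assumes "lin f"
  shows "rshift f a \<in> hom_unital"
proof -
  obtain z where "z * a = a" using local_unit[of "{a}"] by auto
  then have "rshift (rshift f a) z = rshift f a" by (simp add: rshift_rshift)
  then show ?thesis using lin_rshift[OF assms] by (auto simp: hom_unital_def)
qed

lemma hom_unital_lin: "h \<in> hom_unital \<Longrightarrow> lin h"
  by (simp add: hom_unital_def)

text \<open>If \<open>z\<close> is a left unit for every chosen \<open>e h\<close>, then shifting by
  \<open>z\<close> fixes \<open>h\<close>, because \<open>h\<close> is already a shift by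
  \<open>e h\<close>.\<close>

lemma hom_unital_common_unit:
  assumes "finite K" "K \<subseteq> hom_unital"
  shows "\<exists>e. \<forall>h\<in>K. rshift h e = h"
proof -
  have "\<forall>h\<in>K. \<exists>e. rshift h e = h" using assms(2) by (auto simp: hom_unital_def)
  then obtain e where e: "\<forall>h\<in>K. rshift h (e h) = h" by (rule bchoice[THEN exE])
  obtain z where z: "\<forall>x\<in>e ` K. x * z = x \<and> z * x = x"
    using local_unit[of "e ` K"] assms(1) by auto
  have "rshift h z = h" if "h \<in> K" for h
  proof -
    have "rshift h (e h) = h" "z * e h = e h" using e z that by auto
    then show ?thesis by (metis rshift_rshift)
  qed
  then show ?thesis by blast
qed

lemma hom_unital_add:
  assumes "h \<in> hom_unital" "k \<in> hom_unital"
  shows "h + k \<in> hom_unital"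
proof -
  obtain e where "rshift h e = h" "rshift k e = k"
    using hom_unital_common_unit[of "{h, k}"] assms by auto
  then have "rshift (h + k) e = h + k" by (simp add: rshift_add)
  moreover have "lin (h + k)"
  proof -
    interpret L: vector_space sL by (rule vs_L)
    show ?thesis using assms[THEN hom_unital_lin]
      by (simp add: lin_iff plus_fun_apply L.scale_right_distrib)
  qed
  ultimately show ?thesis by (auto simp: hom_unital_def)
qed

lemma hom_unital_zero: "0 \<in> hom_unital"
proof -
  interpret L: vector_space sL by (rule vs_L)
  have "lin 0" "rshift 0 0 = (0 :: 'a \<Rightarrow> 'l)"
    by (simp_all add: lin_iff rshift_def zero_fun_apply fun_eq_iff)
  then show ?thesis by (auto simp: hom_unital_def)
qed

lemma hom_unital_scale:
  assumes "h \<in> hom_unital"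
  shows "fscale sL c h \<in> hom_unital"
proof -
  interpret L: vector_space sL by (rule vs_L)
  obtain e where "rshift h e = h" using assms by (auto simp: hom_unital_def)
  then have "rshift (fscale sL c h) e = fscale sL c h" by (simp add: rshift_scale)
  moreover have "lin (fscale sL c h)"
    using hom_unital_lin[OF assms]
    by (simp add: lin_iff fscale_def L.scale_right_distrib L.scale_left_commute)
  ultimately show ?thesis by (auto simp: hom_unital_def)
qed

section \<open>The convolution product and its independence of presentations\<close>

lemma bilinear_prod: "lin f \<Longrightarrow> lin g \<Longrightarrow> bilinear_map s sL (\<lambda>p q. f p * g q)"
  by (simp add: lin_iff bilinear_map_iff distrib_left distrib_right L_scale_left L_scale_right)

text \<open>The first form depends on \<open>f\<close> and \<open>a\<close> only through
  \<open>rshift f a\<close>, the second on \<open>g\<close> and \<open>b\<close> only through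
  \<open>rshift g b\<close>. Together they make the convolution product well defined.\<close>

lemma lift_Delta_tens:
  assumes "lin f" "lin g"
  shows "tensor_lift s (\<lambda>p q. f p * g q) (fst (\<Delta> c) (tens s a b)) =
      tensor_lift s (\<lambda>p q. rshift f a p * g q) (r2 c b)"
    "tensor_lift s (\<lambda>p q. f p * g q) (fst (\<Delta> c) (tens s a b)) =
      tensor_lift s (\<lambda>p q. f p * rshift g b q) (r1 c a)"
proof -
  note b = bilinear_prod[OF assms]
  show "tensor_lift s (\<lambda>p q. f p * g q) (fst (\<Delta> c) (tens s a b)) =
      tensor_lift s (\<lambda>p q. rshift f a p * g q) (r2 c b)"
    unfolding rshift_def Delta_tens_r2
    by (rule lift_lift_tens[OF vs_L b r2_in_space bilinear_tens_precomp(2)])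
  show "tensor_lift s (\<lambda>p q. f p * g q) (fst (\<Delta> c) (tens s a b)) =
      tensor_lift s (\<lambda>p q. f p * rshift g b q) (r1 c a)"
    unfolding rshift_def Delta_tens_r1
    by (rule lift_lift_tens[OF vs_L b r1_in_space bilinear_tens_precomp(4)])
qed

lemma conv_rshift:
  assumes f: "lin f" and g: "lin g"
  shows "conv (rshift f a) (rshift g b) =
    (\<lambda>c. tensor_lift s (\<lambda>p q. f p * g q) (fst (\<Delta> c) (tens s a b)))"
  unfolding hom_r_mult_def
proof (rule the_equality)
  show "\<exists>f' a' g' b'. lin f' \<and> lin g' \<and> rshift f a = rshift f' a' \<and> rshift g b = rshift g' b' \<and>
      (\<lambda>c. tensor_lift s (\<lambda>p q. f p * g q) (fst (\<Delta> c) (tens s a b))) =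
      (\<lambda>c. tensor_lift s (\<lambda>p q. f' p * g' q) (fst (\<Delta> c) (tens s a' b')))"
    using f g by blast
next
  fix m
  assume "\<exists>f' a' g' b'. lin f' \<and> lin g' \<and> rshift f a = rshift f' a' \<and> rshift g b = rshift g' b' \<and>
      m = (\<lambda>c. tensor_lift s (\<lambda>p q. f' p * g' q) (fst (\<Delta> c) (tens s a' b')))"
  then obtain f' a' g' b' where f': "lin f'" and g': "lin g'"
    and eq: "rshift f a = rshift f' a'" "rshift g b = rshift g' b'"
    and m: "m = (\<lambda>c. tensor_lift s (\<lambda>p q. f' p * g' q) (fst (\<Delta> c) (tens s a' b')))"
    by blast
  show "m = (\<lambda>c. tensor_lift s (\<lambda>p q. f p * g q) (fst (\<Delta> c) (tens s a b)))"
  proof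
    fix c
    \<comment> \<open>The presentations are exchanged one at a time: first that of the right factor,
      passing through the mixed term in \<open>f'\<close> and \<open>g\<close>, then that of the
      left factor.\<close>
    have "m c = tensor_lift s (\<lambda>p q. f' p * rshift g' b' q) (r1 c a')"
      by (simp only: m lift_Delta_tens(2)[OF f' g'])
    also have "\<dots> = tensor_lift s (\<lambda>p q. f' p * g q) (fst (\<Delta> c) (tens s a' b))"
      by (simp only: eq(2)[symmetric] lift_Delta_tens(2)[OF f' g])
    also have "\<dots> = tensor_lift s (\<lambda>p q. rshift f a p * g q) (r2 c b)"
      by (simp only: eq(1) lift_Delta_tens(1)[OF f' g])
    also have "\<dots> = tensor_lift s (\<lambda>p q. f p * g q) (fst (\<Delta> c) (tens s a b))"
      by (simp only: lift_Delta_tens(1)[OF f g])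
    finally show "m c = tensor_lift s (\<lambda>p q. f p * g q) (fst (\<Delta> c) (tens s a b))" .
  qed
qed

text \<open>With \<open>h\<close> presented as a shift of itself by a unit, the \<open>r2\<close>
  form refers to \<open>h\<close> directly and only the right factor needs a presentation.\<close>

lemma conv_r2:
  assumes "h \<in> hom_unital" "lin g"
  shows "conv h (rshift g b) = (\<lambda>c. tensor_lift s (\<lambda>p q. h p * g q) (r2 c b))"
proof -
  obtain e where e: "rshift h e = h" "lin h" using assms(1) by (auto simp: hom_unital_def)
  show ?thesis
    using conv_rshift[OF e(2) assms(2), of e b] lift_Delta_tens(1)[OF e(2) assms(2), of _ e b]
    by (simp add: e(1))
qed

lemma conv_r1:
  assumes "lin f" "k \<in> hom_unital"
  shows "conv (rshift f a) k = (\<lambda>c. tensor_lift s (\<lambda>p q. f p * k q) (r1 c a))"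
proof -
  obtain e where e: "rshift k e = k" "lin k" using assms(2) by (auto simp: hom_unital_def)
  show ?thesis
    using conv_rshift[OF assms(1) e(2), of a e] lift_Delta_tens(2)[OF assms(1) e(2), of _ a e]
    by (simp add: e(1))
qed

text \<open>The \<open>r2\<close> form is additive in the unshifted left factor; the
  \<open>r1\<close> form plays this role for the right factor.\<close>

lemma conv_add_left:
  assumes "h \<in> hom_unital" "h' \<in> hom_unital" "k \<in> hom_unital"
  shows "conv (h + h') k = conv h k + conv h' k"
proof -
  obtain e where e: "rshift k e = k" "lin k" using assms(3) by (auto simp: hom_unital_def)
  note b = bilinear_prod[OF assms(1)[THEN hom_unital_lin] e(2)]
    bilinear_prod[OF assms(2)[THEN hom_unital_lin] e(2)]
  show ?thesis
    using conv_r2[OF hom_unital_add[OF assms(1,2)] e(2), of e] conv_r2[OF assms(1) e(2), of e]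
      conv_r2[OF assms(2) e(2), of e] lift_add_fun[OF vs_L b r2_in_space]
    by (simp add: e(1) plus_fun_apply distrib_right fun_eq_iff)
qed

lemma conv_add_right:
  assumes "h \<in> hom_unital" "k \<in> hom_unital" "k' \<in> hom_unital"
  shows "conv h (k + k') = conv h k + conv h k'"
proof -
  obtain e where e: "rshift h e = h" "lin h" using assms(1) by (auto simp: hom_unital_def)
  note b = bilinear_prod[OF e(2) assms(2)[THEN hom_unital_lin]]
    bilinear_prod[OF e(2) assms(3)[THEN hom_unital_lin]]
  show ?thesis
    using conv_r1[OF e(2) hom_unital_add[OF assms(2,3)], of e] conv_r1[OF e(2) assms(2), of e]
      conv_r1[OF e(2) assms(3), of e] lift_add_fun[OF vs_L b r1_in_space]
    by (simp add: e(1) plus_fun_apply distrib_left fun_eq_iff)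
qed

lemma conv_scale_left:
  assumes "h \<in> hom_unital" "k \<in> hom_unital"
  shows "conv (fscale sL c h) k = fscale sL c (conv h k)"
proof -
  obtain e where e: "rshift k e = k" "lin k" using assms(2) by (auto simp: hom_unital_def)
  show ?thesis
    using conv_r2[OF hom_unital_scale[OF assms(1)] e(2), of c e] conv_r2[OF assms(1) e(2), of e]
      lift_scale_fun[OF vs_L bilinear_prod[OF assms(1)[THEN hom_unital_lin] e(2)] r2_in_space]
    by (simp add: e(1) fscale_def L_scale_left fun_eq_iff)
qed

lemma conv_scale_right:
  assumes "h \<in> hom_unital" "k \<in> hom_unital"
  shows "conv h (fscale sL c k) = fscale sL c (conv h k)"
proof -
  obtain e where e: "rshift h e = h" "lin h" using assms(1) by (auto simp: hom_unital_def)
  show ?thesis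
    using conv_r1[OF e(2) hom_unital_scale[OF assms(2)], of e c] conv_r1[OF e(2) assms(2), of e]
      lift_scale_fun[OF vs_L bilinear_prod[OF e(2) assms(2)[THEN hom_unital_lin]] r1_in_space]
    by (simp add: e(1) fscale_def L_scale_right fun_eq_iff)
qed

lemma linear_mult_left: "Vector_Spaces.linear sL sL (\<lambda>x. y * x)"
  and linear_mult_right: "Vector_Spaces.linear sL sL (\<lambda>x. x * y)"
  by (simp_all add: linear_iff[OF vs_L vs_L] distrib_left distrib_right L_scale_left L_scale_right)

text \<open>With a common unit \<open>e\<close> of \<open>h\<close> and \<open>l\<close>, the two
  bracketings become the two iterated lifts of \<open>coassoc_r1\<close> for the trilinear map built
  from \<open>h\<close>, \<open>k\<close> and \<open>l\<close>. The membership assumptions on the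
  products are supplied on \<open>R\<close> by \<open>conv_in_R\<close>.\<close>

lemma conv_assoc:
  assumes "h \<in> hom_unital" "k \<in> hom_unital" "l \<in> hom_unital"
    and "conv h k \<in> hom_unital" "conv k l \<in> hom_unital"
  shows "conv (conv h k) l = conv h (conv k l)"
proof
  fix c
  obtain e where e: "rshift h e = h" "rshift l e = l"
    using hom_unital_common_unit[of "{h, l}"] assms by auto
  note lin = assms(1-3)[THEN hom_unital_lin]
  have \<tau>: "trilinear_map s sL (\<lambda>u v q. h u * k v * l q)"
    using lin by (simp add: trilinear_map_def bilinear_map_iff linear_on_def lin_iff distrib_left
        distrib_right L_scale_left L_scale_right)
  have hk: "conv h k p * l q = tensor_lift s (\<lambda>u v. h u * k v * l q) (r1 p e)" for p q
    using conv_r1[OF lin(1) assms(2), of e]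
      lift_comp_linear[OF bilinear_prod[OF lin(1,2)] linear_mult_right r1_in_space]
    by (simp add: e(1))
  have kl: "h p * conv k l q = tensor_lift s (\<lambda>u v. h p * k u * l v) (r2 q e)" for p q
    using conv_r2[OF assms(2) lin(3), of e]
      lift_comp_linear[OF bilinear_prod[OF lin(2,3)] linear_mult_left r2_in_space]
    by (simp add: e(2) mult.assoc)
  have "conv (conv h k) l c = tensor_lift s (\<lambda>p q. conv h k p * l q) (r2 c e)"
    using conv_r2[OF assms(4) lin(3), of e] by (simp add: e(2))
  also have "\<dots> = tensor_lift s (\<lambda>p q. h p * conv k l q) (r1 c e)"
    unfolding hk kl by (rule coassoc_r1[OF vs_L \<tau>])
  also have "\<dots> = conv h (conv k l) c"
    using conv_r1[OF lin(1) assms(5), of e] by (simp add: e(1))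
  finally show "conv (conv h k) l c = conv h (conv k l) c" .
qed

section \<open>The action on products, and the use of surjectivity\<close>

lemma linear_on_lift_Delta:
  assumes "bilinear_map s sL f"
  shows "linear_on (fscale (*)) sL (tensor_space s) UNIV (\<lambda>t. tensor_lift s f (fst (\<Delta> c) t))"
  using lift_add[OF vs_L assms] lift_scale[OF vs_L assms]
  by (simp add: linear_on_def Delta_add Delta_scale Delta_in_space)

text \<open>The value of the left side at \<open>c\<close> is that of the product at
  \<open>c * a\<close>, a lift over \<open>r2 (c * a) e\<close>. By \<open>Delta_r2\<close> this
  tensor is \<open>\<Delta> c\<close> applied to \<open>r2 a e\<close>, and expanding
  \<open>r2 a e\<close> into elementary tensors yields products of shifted maps.\<close>

lemma act_conv:
  assumes h: "h \<in> hom_unital" and k: "lin k" "rshift k e = k"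
  shows "hom_r_act a (conv h k) =
    tensor_lift s (\<lambda>p q. conv (hom_r_act p h) (hom_r_act q k)) (r2 a e)"
proof
  fix c :: 'a
  note b = bilinear_prod[OF hom_unital_lin[OF h] k(1)]
  have ev: "Vector_Spaces.linear (fscale sL) sL (\<lambda>f. f c)"
    by (rule linear_evaluation[OF vs_L])
  let ?f = "\<lambda>p q. conv (hom_r_act p h) (hom_r_act q k)"
  have f: "?f p q = (\<lambda>c. tensor_lift s (\<lambda>p q. h p * k q) (fst (\<Delta> c) (tens s p q)))" for p q
    by (simp add: hom_r_act_def conv_rshift[OF hom_unital_lin[OF h] k(1)])
  have "bilinear_map s (fscale sL) ?f"
    using linear_on_lift_Delta[OF b]
    by (simp add: f bilinear_map_iff linear_on_def fun_eq_iff plus_fun_apply fscale_def[of sL]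
        tens_simps)
  from lift_comp_linear[OF this ev r2_in_space]
  have "tensor_lift s ?f (r2 a e) c = tensor_lift s (\<lambda>p q. ?f p q c) (r2 a e)" by simp
  also have "\<dots> = tensor_lift s (\<lambda>p q. h p * k q) (fst (\<Delta> c) (r2 a e))"
    using lift_comp[OF vector_space_tensor bilinear_tens vs_L linear_on_lift_Delta[OF b]
        subspace_tensor_space tens_in_space r2_in_space]
    by (simp add: f lift_tens_id)
  also have "\<dots> = conv h k (c * a)"
    using conv_r2[OF h k(1), of e] by (simp add: k(2) Delta_r2)
  finally show "hom_r_act a (conv h k) c = tensor_lift s ?f (r2 a e) c"
    by (simp add: hom_r_act_def rshift_def)
qed

text \<open>By \<open>r2_surj\<close> every elementary tensor is a sum of covered products, on each
  of which the lift vanishes.\<close>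

lemma vanish_if_vanish_r2:
  assumes f: "bilinear_map s sL f" and zero: "\<And>a b. tensor_lift s f (r2 a b) = 0"
  shows "f p q = 0"
proof -
  obtain ps where ps: "tens s p q = (\<Sum>(a, b)\<leftarrow>ps. r2 a b)"
    using tens_in_space by (rule r2_surj)
  have "tensor_lift s f (\<Sum>(a, b)\<leftarrow>ps. r2 a b) = 0 \<and> (\<Sum>(a, b)\<leftarrow>ps. r2 a b) \<in> tensor_space s"
    by (induction ps) (auto simp: zero lift_zero[OF vs_L f] lift_add[OF vs_L f])
  then show ?thesis using lift_tens[OF vs_L f, of p q] by (simp add: ps)
qed

lemma vanish_if_vanish_r1:
  assumes f: "bilinear_map s sL f" and zero: "\<And>a b. tensor_lift s f (r1 a b) = 0"
  shows "f p q = 0"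
proof -
  obtain ps where ps: "tens s p q = (\<Sum>(a, b)\<leftarrow>ps. r1 a b)"
    using tens_in_space by (rule r1_surj)
  have "tensor_lift s f (\<Sum>(a, b)\<leftarrow>ps. r1 a b) = 0 \<and> (\<Sum>(a, b)\<leftarrow>ps. r1 a b) \<in> tensor_space s"
    by (induction ps) (auto simp: zero lift_zero[OF vs_L f] lift_add[OF vs_L f])
  then show ?thesis using lift_tens[OF vs_L f, of p q] by (simp add: ps)
qed

end

section \<open>The globalization\<close>

locale quasi_unitary_action = hopf_convolution s \<Delta> sL
  for s :: "'k::field \<Rightarrow> 'a::ring \<Rightarrow> 'a" and \<Delta> :: "('a, 'k) comult" and sL :: "'k \<Rightarrow> 'l::ring \<Rightarrow> 'l" +
  fixes dot :: "'a \<Rightarrow> 'l \<Rightarrow> 'l"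
  assumes L_nondegenerate: "nondegenerate_product (UNIV :: 'l set) (*)"
    and dot_bilinear: "bilinear_on s sL sL UNIV UNIV UNIV dot"
    and dot_mult_right: "dot a (x * dot b y) = tensor_lift s (\<lambda>p q. dot p x * dot q y) (cov_r2 s \<Delta> a b)"
    and dot_mult_left: "dot a (dot b x * y) = tensor_lift s (\<lambda>p q. dot p x * dot q y) (cov_r1 s \<Delta> a b)"
    and dot_unit: "\<exists>b. dot b x = x \<and> (\<forall>a. dot (a * b) x = dot a x)"
begin

abbreviation "\<phi> \<equiv> phi dot"
abbreviation "R \<equiv> act_span (fscale sL) hom_r_act (range \<phi>)"
abbreviation "\<pi> \<equiv> pi' s sL dot"

lemma vs_R: "vector_space (fscale sL :: 'k \<Rightarrow> ('a \<Rightarrow> 'l) \<Rightarrow> 'a \<Rightarrow> 'l)"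
  by (rule vector_space_fscale[OF vs_L])

interpretation F: vector_space "fscale sL :: 'k \<Rightarrow> ('a \<Rightarrow> 'l) \<Rightarrow> 'a \<Rightarrow> 'l"
  by (rule vs_R)

section \<open>The map \<open>\<phi>\<close> of the partial action\<close>

lemma dot_simps:
  "dot (a + b) x = dot a x + dot b x" "dot (s c a) x = sL c (dot a x)"
  "dot a (x + y) = dot a x + dot a y" "dot a (sL c x) = sL c (dot a x)"
  using dot_bilinear by (auto simp: bilinear_on_def linear_on_def)

lemma lin_phi: "lin (\<phi> x)"
  by (simp add: lin_iff phi_def dot_simps)

lemma phi_add: "\<phi> (x + y) = \<phi> x + \<phi> y"
  and phi_scale: "\<phi> (sL c x) = fscale sL c (\<phi> x)"
  by (simp_all add: phi_def dot_simps fun_eq_iff plus_fun_apply fscale_def)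

lemma phi_zero: "\<phi> 0 = 0"
  using phi_add[of 0 0] by simp

lemma subspace_range_phi: "module.subspace (fscale sL) (range \<phi>)"
proof (rule F.subspaceI)
  show "0 \<in> range \<phi>" by (rule range_eqI[of _ _ 0]) (simp only: phi_zero)
  show "u + v \<in> range \<phi>" if "u \<in> range \<phi>" "v \<in> range \<phi>" for u v
  proof -
    from that obtain x y where "u = \<phi> x" "v = \<phi> y" by blast
    then show ?thesis by (intro range_eqI[of _ _ "x + y"]) (simp add: phi_add)
  qed
  show "fscale sL c u \<in> range \<phi>" if "u \<in> range \<phi>" for c u
  proof -
    from that obtain x where "u = \<phi> x" by blast
    then show ?thesis by (intro range_eqI[of _ _ "sL c x"]) (simp add: phi_scale)
  qed
qed

lemmas range_phi_add = F.subspace_add[OF subspace_range_phi]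
  and range_phi_zero = F.subspace_0[OF subspace_range_phi]

text \<open>Quasi unitarity is exactly what places \<open>\<phi> x\<close> in
  \<open>hom_unital\<close>, with the same element also fixing \<open>x\<close>.\<close>

lemma phi_unit: "\<exists>b. rshift (\<phi> x) b = \<phi> x \<and> dot b x = x"
  using dot_unit[of x] by (auto simp: rshift_def phi_def)

lemma phi_in_hom_unital: "\<phi> x \<in> hom_unital"
  using phi_unit[of x] lin_phi by (auto simp: hom_unital_def)

text \<open>An element fixing \<open>x - y\<close> recovers the difference from the values of
  \<open>\<phi> x\<close> and \<open>\<phi> y\<close> at that element.\<close>

lemma inj_phi: "inj \<phi>"
proof (rule injI)
  fix x y assume eq: "\<phi> x = \<phi> y"
  have "x - y = 0"
  proof -
    obtain b where "dot b (x - y) = x - y" using dot_unit[of "x - y"] by blast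
    moreover have "dot b x = dot b ((x - y) + y)" by simp
    then have "dot b x = dot b (x - y) + dot b y" by (simp only: dot_simps)
    ultimately show ?thesis using fun_cong[OF eq, of b] by (simp add: phi_def)
  qed
  then show "x = y" by simp
qed

subsection \<open>The space \<open>R\<close>\<close>

lemma act_phi_in_R: "rshift (\<phi> x) a \<in> R"
  unfolding act_span_def by (rule F.span_base) (auto simp: hom_r_act_def)

lemma subspace_R: "F.subspace R"
  unfolding act_span_def by (rule F.subspace_span)

lemmas R_add = F.subspace_add[OF subspace_R]
  and R_zero = F.subspace_0[OF subspace_R]
  and R_scale = F.subspace_scale[OF subspace_R]

lemma phi_in_R: "\<phi> x \<in> R"
  using phi_unit[of x] act_phi_in_R[of x] by metis

text \<open>There is no scalar case: a scalar in front of a generator moves into the vector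
  \<open>x\<close>.\<close>

lemma R_induct [consumes 1, case_names zero gen add]:
  assumes "r \<in> R" and "P 0" and "\<And>a x. P (rshift (\<phi> x) a)"
    and "\<And>r t. r \<in> R \<Longrightarrow> t \<in> R \<Longrightarrow> P r \<Longrightarrow> P t \<Longrightarrow> P (r + t)"
  shows "P r"
proof -
  have "r \<in> R \<and> P r"
    using assms(1) unfolding act_span_def
  proof (induction rule: F.span_induct_alt)
    case base
    show ?case using assms(2) F.span_zero by blast
  next
    case (step c g t)
    then obtain a x where "g = rshift (\<phi> x) a" by (auto simp: hom_r_act_def)
    then have "fscale sL c g = rshift (\<phi> (sL c x)) a"
      by (simp add: phi_scale rshift_scale)
    then have g: "fscale sL c g \<in> R" "P (fscale sL c g)"
      by (simp_all only: act_phi_in_R assms(3))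
    have t: "t \<in> R" "P t" using step.IH unfolding act_span_def by auto
    show ?case using R_add[OF g(1) t(1)] assms(4)[OF g(1) t(1) g(2) t(2)]
      unfolding act_span_def by (rule conjI)
  qed
  then show ?thesis ..
qed

lemma R_subset_hom_unital: "r \<in> R \<Longrightarrow> r \<in> hom_unital"
  by (induction rule: R_induct)
    (auto intro: hom_unital_zero hom_unital_add rshift_in_hom_unital lin_phi)

lemma act_in_R: "r \<in> R \<Longrightarrow> rshift r a \<in> R"
proof (induction rule: R_induct)
  case zero
  have "rshift 0 a = (0 :: 'a \<Rightarrow> 'l)" by (simp add: rshift_def fun_eq_iff zero_fun_apply)
  then show ?case by (simp add: R_zero)
next
  case (gen b x)
  show ?case by (simp add: rshift_rshift act_phi_in_R)
next
  case (add r t)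
  then show ?case by (simp add: rshift_add R_add)
qed

subsection \<open>The projection\<close>

text \<open>Two presentations of the same map agree at a common left unit of \<open>a\<close> and
  \<open>b\<close>, where they take the values \<open>f a\<close> and \<open>g b\<close>. Hence the
  definite description in \<open>pi'\<close> denotes.\<close>

lemma pi_rshift:
  assumes f: "lin f"
  shows "\<pi> (rshift f a) = \<phi> (f a)"
  unfolding pi'_def
proof (rule the_equality)
  show "\<exists>g b. lin g \<and> rshift f a = rshift g b \<and> \<phi> (f a) = \<phi> (g b)" using f by blast
next
  fix k assume "\<exists>g b. lin g \<and> rshift f a = rshift g b \<and> k = \<phi> (g b)"
  then obtain g b where g: "rshift f a = rshift g b" "k = \<phi> (g b)" by blast
  obtain z where "z * a = a" "z * b = b" using local_unit[of "{a, b}"] by auto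
  then show "k = \<phi> (f a)"
    using fun_cong[OF g(1), of z] g(2) by (simp add: rshift_def)
qed

text \<open>The projection is evaluation at a unit of \<open>h\<close> followed by
  \<open>\<phi>\<close>; its linearity follows by evaluating at common units.\<close>

lemma pi_unit: "lin h \<Longrightarrow> rshift h e = h \<Longrightarrow> \<pi> h = \<phi> (h e)"
  using pi_rshift[of h e] by simp

lemma pi_add:
  assumes "h \<in> hom_unital" "k \<in> hom_unital"
  shows "\<pi> (h + k) = \<pi> h + \<pi> k"
proof -
  obtain e where e: "rshift h e = h" "rshift k e = k" "rshift (h + k) e = h + k"
    using hom_unital_common_unit[of "{h, k, h + k}"] assms hom_unital_add[OF assms] by auto
  have "\<pi> h = \<phi> (h e)" "\<pi> k = \<phi> (k e)" "\<pi> (h + k) = \<phi> ((h + k) e)"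
    using e assms hom_unital_add[OF assms] by (auto intro: pi_unit hom_unital_lin)
  then show ?thesis by (simp add: plus_fun_apply phi_add)
qed

lemma pi_zero: "\<pi> 0 = 0"
  using pi_add[OF hom_unital_zero hom_unital_zero] by simp

lemma pi_scale:
  assumes "h \<in> hom_unital"
  shows "\<pi> (fscale sL c h) = fscale sL c (\<pi> h)"
proof -
  obtain e where e: "rshift h e = h" using assms by (auto simp: hom_unital_def)
  then have "rshift (fscale sL c h) e = fscale sL c h" by (simp add: rshift_scale)
  then have "\<pi> (fscale sL c h) = \<phi> (fscale sL c h e)"
    by (rule pi_unit[OF hom_unital_lin[OF hom_unital_scale[OF assms]]])
  then show ?thesis
    using pi_unit[OF hom_unital_lin[OF assms] e] by (simp add: fscale_def[of sL c h] phi_scale)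
qed

lemma pi_phi: "\<pi> (\<phi> x) = \<phi> x"
proof -
  obtain b where "rshift (\<phi> x) b = \<phi> x" "dot b x = x" using phi_unit by blast
  then show ?thesis using pi_rshift[OF lin_phi, of x b] by (simp add: phi_def)
qed

lemma pi_act_phi: "\<pi> (rshift (\<phi> x) a) = \<phi> (dot a x)"
  by (simp add: pi_rshift[OF lin_phi]) (simp add: phi_def)

lemma pi_in_range: "r \<in> R \<Longrightarrow> \<pi> r \<in> range \<phi>"
proof (induction rule: R_induct)
  case zero
  show ?case by (simp only: pi_zero range_phi_zero)
next
  case (gen a x)
  show ?case by (simp add: pi_act_phi)
next
  case (add r t)
  then show ?case by (simp add: pi_add R_subset_hom_unital range_phi_add)
qed

subsection \<open>Products in \<open>R\<close>\<close>

lemma conv_phi_act: "conv (\<phi> x) (rshift (\<phi> y) b) = \<phi> (x * dot b y)"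
  unfolding conv_r2[OF phi_in_hom_unital lin_phi] by (simp add: phi_def dot_mult_right)

lemma conv_act_phi: "conv (rshift (\<phi> x) a) (\<phi> y) = \<phi> (dot a x * y)"
  unfolding conv_r1[OF lin_phi phi_in_hom_unital] by (simp add: phi_def dot_mult_left)

lemma conv_phi: "conv (\<phi> x) (\<phi> y) = \<phi> (x * y)"
proof -
  obtain b where "rshift (\<phi> y) b = \<phi> y" "dot b y = y" using phi_unit by blast
  then show ?thesis using conv_phi_act[of x y b] by simp
qed

lemma conv_generators:
  "conv (rshift (\<phi> x) a) (rshift (\<phi> y) b) \<in> R"
  "\<pi> (conv (rshift (\<phi> x) a) (rshift (\<phi> y) b)) = \<phi> (dot a x * dot b y)"
proof -
  note bl = bilinear_prod[OF lin_phi[of x] lin_phi[of y]]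
  let ?l = "tensor_lift s (\<lambda>p q. \<phi> x p * \<phi> y q)"
  \<comment> \<open>\<open>M\<close> extends the product of the two generators from
    \<open>tens s a b\<close> to all tensors. On \<open>r2 a b\<close> it is a single generator,
    which makes membership in \<open>R\<close> and the value of \<open>\<pi>\<close>
    visible.\<close>
  define M where "M t = (\<lambda>c. ?l (fst (\<Delta> c) t))" for t
  have M_zero: "M 0 = 0"
    by (simp add: M_def Delta_zero lift_zero[OF vs_L bl] fun_eq_iff zero_fun_apply)
  have M_add: "M (t + u) = M t + M u" if "t \<in> tensor_space s" "u \<in> tensor_space s" for t u
    using that
    by (simp add: M_def Delta_add Delta_in_space lift_add[OF vs_L bl] fun_eq_iff plus_fun_apply)
  have l_r2: "?l (r2 a b) = dot a (x * dot b y)" for a b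
    by (simp add: phi_def dot_mult_right)
  have M_r2: "M (r2 a b) = rshift (\<phi> (x * dot b y)) a" for a b
    by (simp add: M_def Delta_r2 l_r2 fun_eq_iff) (simp add: rshift_def phi_def)
  obtain ps where ps: "tens s a b = (\<Sum>(a, b)\<leftarrow>ps. r2 a b)"
    using tens_in_space by (rule r2_surj)
  define t where "t = (\<Sum>(a, b)\<leftarrow>ps. r2 a b)"
  \<comment> \<open>The three claims are proved together, since additivity of \<open>M\<close> needs
    membership in the tensor space and additivity of \<open>\<pi>\<close> needs membership in
    \<open>R\<close>.\<close>
  have "t \<in> tensor_space s \<and> M t \<in> R \<and> \<pi> (M t) = \<phi> (?l t)"
    unfolding t_def
  proof (induction ps)
    case Nil
    show ?case by (simp add: M_zero R_zero pi_zero lift_zero[OF vs_L bl] phi_zero)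
  next
    case (Cons p ps)
    obtain c d where p: "p = (c, d)" by (cases p)
    show ?case
      using Cons
      by (simp add: p M_add M_r2 R_add act_phi_in_R pi_add R_subset_hom_unital pi_act_phi
          lift_add[OF vs_L bl] l_r2 phi_add)
  qed
  moreover have "M t = conv (rshift (\<phi> x) a) (rshift (\<phi> y) b)"
    by (simp add: M_def t_def ps[symmetric] conv_rshift[OF lin_phi lin_phi])
  moreover have "?l t = dot a x * dot b y"
    by (simp add: t_def ps[symmetric] lift_tens[OF vs_L bl]) (simp add: phi_def)
  ultimately show "conv (rshift (\<phi> x) a) (rshift (\<phi> y) b) \<in> R"
    "\<pi> (conv (rshift (\<phi> x) a) (rshift (\<phi> y) b)) = \<phi> (dot a x * dot b y)"
    by auto
qed

lemma conv_zero_left: "k \<in> hom_unital \<Longrightarrow> conv 0 k = 0"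
  using conv_add_left[OF hom_unital_zero hom_unital_zero] by simp

lemma conv_zero_right: "h \<in> hom_unital \<Longrightarrow> conv h 0 = 0"
  using conv_add_right[OF _ hom_unital_zero hom_unital_zero] by simp

lemma conv_R:
  assumes "r \<in> R" "t \<in> R"
  shows "conv r t \<in> R \<and> \<pi> (conv r t) = conv (\<pi> r) (\<pi> t)"
proof -
  have phi_range: "\<pi> u \<in> hom_unital" if "u \<in> R" for u
    using pi_in_range[OF that] phi_in_hom_unital by auto
  \<comment> \<open>Induction on the right factor against a fixed generator; the induction on the
    left factor afterwards uses this as its generator case.\<close>
  have left_gen: "conv (rshift (\<phi> x) a) t \<in> R \<and>
      \<pi> (conv (rshift (\<phi> x) a) t) = conv (\<pi> (rshift (\<phi> x) a)) (\<pi> t)" for x a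
    using assms(2)
  proof (induction rule: R_induct)
    case zero
    show ?case
      by (simp add: conv_zero_right pi_zero R_zero rshift_in_hom_unital lin_phi phi_range act_phi_in_R)
  next
    case (gen b y)
    show ?case by (simp add: conv_generators pi_act_phi conv_phi)
  next
    case (add t u)
    then show ?case
      by (simp add: conv_add_right pi_add R_add R_subset_hom_unital act_phi_in_R phi_range)
  qed
  show ?thesis
    using assms(1)
  proof (induction rule: R_induct)
    case zero
    show ?case
      using assms(2) by (simp add: conv_zero_left pi_zero R_zero R_subset_hom_unital phi_range)
  next
    case (gen a x)
    show ?case by (rule left_gen)
  next
    case (add r u)
    then show ?case
      using assms(2) by (simp add: conv_add_left pi_add R_add R_subset_hom_unital phi_range)
  qed
qed

lemmas conv_in_R = conv_R[THEN conjunct1]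
  and pi_conv = conv_R[THEN conjunct2]

text \<open>On generators of \<open>R\<close> the two claims are \<open>conv_act_phi\<close> and
  \<open>conv_phi_act\<close>, one for each of the two multiplicativity axioms of the partial
  action.\<close>

lemma range_phi_ideal:
  assumes "r \<in> R"
  shows "conv r (\<phi> x) \<in> range \<phi>" "conv (\<phi> x) r \<in> range \<phi>"
proof -
  show "conv r (\<phi> x) \<in> range \<phi>"
    using assms
    by (induction rule: R_induct)
      (simp_all add: conv_zero_left phi_in_hom_unital range_phi_zero conv_act_phi conv_add_left
        R_subset_hom_unital range_phi_add)
  show "conv (\<phi> x) r \<in> range \<phi>"
    using assms
    by (induction rule: R_induct)
      (simp_all add: conv_zero_right phi_in_hom_unital range_phi_zero conv_phi_act conv_add_right
        R_subset_hom_unital range_phi_add)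
qed

section \<open>Nondegeneracy of the product on \<open>R\<close>\<close>

lemma L_cancel_left:
  assumes "\<And>y. x * y = 0"
  shows "x = (0 :: 'l)"
  by (rule L_nondegenerate[unfolded nondegenerate_product_def, THEN conjunct1, rule_format, OF UNIV_I])
    (rule assms)

lemma L_cancel_right:
  assumes "\<And>y. y * x = 0"
  shows "x = (0 :: 'l)"
  by (rule L_nondegenerate[unfolded nondegenerate_product_def, THEN conjunct2, rule_format, OF UNIV_I])
    (rule assms)

lemma nondegenerate_R: "nondegenerate_product R conv"
  unfolding nondegenerate_product_def
proof (intro conjI ballI impI)
  fix r assume r: "r \<in> R" and zero: "\<forall>t\<in>R. conv r t = 0"
  note hr = R_subset_hom_unital[OF r]
  have "r p = 0" for p
  proof (rule L_cancel_left)
    fix y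
    \<comment> \<open>Since \<open>q\<close> fixes \<open>y\<close>, the vanishing of
      \<open>r p * \<phi> y q\<close> becomes that of \<open>r p * y\<close>, for arbitrary
      \<open>y\<close>.\<close>
    obtain q where q: "dot q y = y" using dot_unit by blast
    have "conv r (rshift (\<phi> y) b) = 0" for b using zero act_phi_in_R by blast
    then have "tensor_lift s (\<lambda>p q. r p * \<phi> y q) (r2 c b) = 0" for c b
      unfolding conv_r2[OF hr lin_phi] by (simp add: fun_eq_iff zero_fun_apply)
    then have "r p * \<phi> y q = 0"
      by (rule vanish_if_vanish_r2[OF bilinear_prod[OF hom_unital_lin[OF hr] lin_phi]])
    then show "r p * y = 0" by (simp add: phi_def q)
  qed
  then show "r = 0" by (simp add: fun_eq_iff zero_fun_apply)
next
  fix r assume r: "r \<in> R" and zero: "\<forall>t\<in>R. conv t r = 0"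
  note hr = R_subset_hom_unital[OF r]
  have "r q = 0" for q
  proof (rule L_cancel_right)
    fix y
    obtain p where p: "dot p y = y" using dot_unit by blast
    have "conv (rshift (\<phi> y) b) r = 0" for b using zero act_phi_in_R by blast
    then have "tensor_lift s (\<lambda>p q. \<phi> y p * r q) (r1 c b) = 0" for c b
      unfolding conv_r1[OF lin_phi hr] by (simp add: fun_eq_iff zero_fun_apply)
    then have "\<phi> y p * r q = 0"
      by (rule vanish_if_vanish_r1[OF bilinear_prod[OF lin_phi hom_unital_lin[OF hr]]])
    then show "y * r q = 0" by (simp add: phi_def p)
  qed
  then show "r = 0" by (simp add: fun_eq_iff zero_fun_apply)
qed

section \<open>\<open>R\<close> as a module algebra\<close>

lemma algebra_R: "algebra_on (fscale sL) R conv"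
  unfolding algebra_on_def
proof (intro conjI ballI)
  show "bilinear_on (fscale sL) (fscale sL) (fscale sL) R R R conv"
    by (simp add: bilinear_on_def linear_on_def conv_in_R conv_add_left conv_add_right
        conv_scale_left conv_scale_right R_subset_hom_unital)
  show "conv (conv x y) z = conv x (conv y z)" if "x \<in> R" "y \<in> R" "z \<in> R" for x y z
    using that by (intro conv_assoc) (simp_all add: conv_in_R R_subset_hom_unital)
qed (rule vs_R subspace_R)+

lemma act_span_R: "act_span (fscale sL) hom_r_act R = R"
proof
  show "act_span (fscale sL) hom_r_act R \<subseteq> R"
    unfolding act_span_def[of _ _ R]
    by (rule F.span_minimal[OF _ subspace_R]) (auto simp: hom_r_act_def act_in_R)
  show "R \<subseteq> act_span (fscale sL) hom_r_act R"
    unfolding act_span_def[of _ _ R]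
  proof
    fix r assume r: "r \<in> R"
    then obtain e where "rshift r e = r"
      using R_subset_hom_unital[OF r] by (auto simp: hom_unital_def)
    then have "r = hom_r_act e r" by (simp add: hom_r_act_def)
    then show "r \<in> F.span {hom_r_act a x |a x. x \<in> R}"
      using r by (intro F.span_base) blast
  qed
qed

lemma module_algebra_R: "module_algebra s \<Delta> (fscale sL) R conv hom_r_act"
  unfolding module_algebra_def
proof (intro conjI allI ballI impI)
  show "algebra_on (fscale sL) R conv" by (rule algebra_R)
  show "nondegenerate_product R conv" by (rule nondegenerate_R)
  show "act_span (fscale sL) hom_r_act R = R" by (rule act_span_R)
  have "rshift r (a + b) = rshift r a + rshift r b" "rshift r (s c a) = fscale sL c (rshift r a)"
    if "r \<in> R" for r a b c
    using hom_unital_lin[OF R_subset_hom_unital[OF that]]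
    by (simp_all add: lin_iff rshift_def fun_eq_iff plus_fun_apply fscale_def distrib_left
        mult_scale_right)
  then show "bilinear_on s (fscale sL) (fscale sL) UNIV R R hom_r_act"
    by (simp add: bilinear_on_def linear_on_def hom_r_act_def act_in_R rshift_add rshift_scale)
  show "hom_r_act a (hom_r_act b x) = hom_r_act (a * b) x" for a b and x :: "'a \<Rightarrow> 'l"
    by (simp add: hom_r_act_def rshift_rshift)
  \<comment> \<open>The condition that \<open>e\<close> fixes \<open>y\<close> under the action
    unfolds to \<open>rshift y e = y\<close>, which is the unit hypothesis of
    \<open>act_conv\<close>.\<close>
  show "hom_r_act a (conv x y) = tensor_lift s (\<lambda>p q. conv (hom_r_act p x) (hom_r_act q y)) (r2 a e)"
    if "x \<in> R" "y \<in> R" "hom_r_act e y = y" for a e x y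
    using that act_conv[OF R_subset_hom_unital hom_unital_lin[OF R_subset_hom_unital]]
    by (simp add: hom_r_act_def)
qed

text \<open>Nondegeneracy of the range is carried over from \<open>L\<close> along the
  multiplicative injection \<open>\<phi>\<close>. Because of \<open>restrict\<close>, each argument
  of the projection has to be shown to lie in \<open>R\<close>.\<close>

lemma symmetric_projection_pi:
  "symmetric_projection (fscale sL) R conv hom_r_act (range \<phi>) (restrict \<pi> R)"
  unfolding symmetric_projection_def
proof (intro conjI allI ballI)
  show "range \<phi> \<subseteq> R" using phi_in_R by auto
  show "algebra_on (fscale sL) (range \<phi>) conv"
    by (auto simp: algebra_on_def vs_R subspace_range_phi bilinear_on_def linear_on_def conv_phi phi_in_hom_unital
        conv_add_left conv_add_right conv_scale_left conv_scale_right mult.assoc)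
  have phi_eq_zero: "\<phi> x = 0 \<longleftrightarrow> x = 0" for x
    using inj_phi phi_zero by (metis injD)
  show "nondegenerate_product (range \<phi>) conv"
    unfolding nondegenerate_product_def
    by (auto simp: conv_phi phi_eq_zero intro: L_cancel_left L_cancel_right)
  have pi_in_R: "\<pi> r \<in> R" if "r \<in> R" for r
    using pi_in_range[OF that] phi_in_R by auto
  show "linear_on (fscale sL) (fscale sL) R R (restrict \<pi> R)"
    by (simp add: linear_on_def R_add R_scale pi_add pi_scale R_subset_hom_unital pi_in_R)
  show "restrict \<pi> R (conv x y) = conv (restrict \<pi> R x) (restrict \<pi> R y)" if "x \<in> R" "y \<in> R" for x y
    using that by (simp add: conv_in_R pi_conv)
  show "restrict \<pi> R ` R = range \<phi>"
  proof
    show "restrict \<pi> R ` R \<subseteq> range \<phi>" using pi_in_range by auto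
    show "range \<phi> \<subseteq> restrict \<pi> R ` R"
    proof
      fix f assume "f \<in> range \<phi>"
      then obtain x where "f = \<phi> x" by blast
      then have "f \<in> R" "f = restrict \<pi> R f" by (simp_all add: phi_in_R pi_phi)
      then show "f \<in> restrict \<pi> R ` R" by blast
    qed
  qed
  show "restrict \<pi> R x = x" if "x \<in> range \<phi>" for x
    using that by (auto simp: phi_in_R pi_phi)
  \<comment> \<open>Both products are already equal before \<open>a\<close> acts: multiplying the
    image of \<open>u\<close> by \<open>b\<close> acting on the image of \<open>v\<close>, or by the
    projection of the latter, gives \<open>\<phi> (u * dot b v)\<close> in either case.\<close>
  show "restrict \<pi> R (hom_r_act a (conv x (hom_r_act b y))) =
      restrict \<pi> R (hom_r_act a (conv x (restrict \<pi> R (hom_r_act b y))))"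
    if "x \<in> range \<phi>" "y \<in> range \<phi>" for a b x y
    using that by (auto simp: hom_r_act_def act_phi_in_R pi_act_phi conv_phi conv_phi_act)
  show "restrict \<pi> R (hom_r_act a (conv (hom_r_act b x) y)) =
      restrict \<pi> R (hom_r_act a (conv (restrict \<pi> R (hom_r_act b x)) y))"
    if "x \<in> range \<phi>" "y \<in> range \<phi>" for a b x y
    using that by (auto simp: hom_r_act_def act_phi_in_R pi_act_phi conv_phi conv_act_phi)
qed

lemma globalization_R:
  "globalization s \<Delta> sL dot (fscale sL) R conv hom_r_act \<phi> (restrict \<pi> R)"
  unfolding globalization_def
proof (intro conjI allI ballI)
  show "module_algebra s \<Delta> (fscale sL) R conv hom_r_act" by (rule module_algebra_R)
  show "linear_on sL (fscale sL) UNIV R \<phi>"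
    by (simp add: linear_on_def phi_in_R phi_add phi_scale)
  show "\<phi> (x * y) = conv (\<phi> x) (\<phi> y)" for x y by (simp add: conv_phi)
  show "inj \<phi>" by (rule inj_phi)
  show "conv r (\<phi> x) \<in> range \<phi>" "conv (\<phi> x) r \<in> range \<phi>" if "r \<in> R" for r x
    using range_phi_ideal[OF that] by auto
  show "symmetric_projection (fscale sL) R conv hom_r_act (range \<phi>) (restrict \<pi> R)"
    by (rule symmetric_projection_pi)
  show "\<phi> (dot a x) = restrict \<pi> R (hom_r_act a (\<phi> x))" for a x
    by (simp add: hom_r_act_def act_phi_in_R pi_act_phi)
qed (rule refl)

end

theorem theorem3p22:
  fixes sA :: "'k::field \<Rightarrow> 'a::ring \<Rightarrow> 'a"
    and \<Delta> :: "('a, 'k) comult"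
    and sL :: "'k \<Rightarrow> 'l::ring \<Rightarrow> 'l"
    and dot :: "'a \<Rightarrow> 'l \<Rightarrow> 'l"
    and e :: "'a \<Rightarrow> 'l multiplier"
  assumes "regular_multiplier_hopf_algebra sA \<Delta>"
    and "symmetric_partial_module_algebra sA \<Delta> sL dot e"
    and "quasi_unitary dot"
  shows "let R = act_span (fscale sL) hom_r_act (range (phi dot));
             \<pi> = restrict (pi' sA sL dot) R
         in globalization sA \<Delta> sL dot (fscale sL) R (hom_r_mult sA \<Delta> sL) hom_r_act (phi dot) \<pi>"
proof -
  note partial = assms(2)[unfolded symmetric_partial_module_algebra_def]
  have A: "algebra_on sA UNIV (*)"
    using assms(1) by (simp add: regular_multiplier_hopf_algebra_def multiplier_hopf_algebra_def)
  have L: "algebra_on sL UNIV (*)" using partial by blast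
  have units: "\<exists>z. \<forall>x\<in>F. x * z = x \<and> z * x = x" if "finite F" for F :: "'a set"
  proof -
    \<comment> \<open>The local unit axiom of the partial action for the empty set of
      vectors.\<close>
    have "\<exists>b. \<forall>a\<in>F. a * b = a \<and> b * a = a \<and> (\<forall>x\<in>{}. dot a x = dot a (dot b x))"
      using partial that by (meson finite.emptyI)
    then show ?thesis by auto
  qed
  \<comment> \<open>Quasi unitarity is used for singletons; common units for several maps are built
    from local units of the algebra.\<close>
  have quasi: "\<exists>b. dot b x = x \<and> (\<forall>a. dot (a * b) x = dot a x)" for x
    using assms(3)[unfolded quasi_unitary_def, rule_format, of "{x}"] by auto
  have dot_axioms: "nondegenerate_product (UNIV :: 'l set) (*)" "bilinear_on sA sL sL UNIV UNIV UNIV dot"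
    "dot a (x * dot b y) = tensor_lift sA (\<lambda>p q. dot p x * dot q y) (cov_r2 sA \<Delta> a b)"
    "dot a (dot b x * y) = tensor_lift sA (\<lambda>p q. dot p x * dot q y) (cov_r1 sA \<Delta> a b)" for a b x y
    using partial by simp_all
  interpret quasi_unitary_action sA \<Delta> sL dot
  proof (intro quasi_unitary_action.intro hopf_convolution.intro regular_hopf.intro
      local_unit_algebra.intro tensor_square.intro quasi_unitary_action_axioms.intro
      hopf_convolution_axioms.intro regular_hopf_axioms.intro local_unit_algebra_axioms.intro)
    show "vector_space sA" "vector_space sL" using A L by (auto simp: algebra_on_def)
    show "sA c x * y = sA c (x * y)" "x * sA c y = sA c (x * y)" for c x y
      using A by (auto simp: algebra_on_def bilinear_on_def linear_on_def)
    show "sL c x * y = sL c (x * y)" "x * sL c y = sL c (x * y)" for c x y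
      using L by (auto simp: algebra_on_def bilinear_on_def linear_on_def)
  qed (rule assms(1) units quasi dot_axioms, assumption?)+
  show ?thesis unfolding Let_def by (rule globalization_R)
qed

end
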